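(* Let $\Re(\mu+\nu)>-1$, and let $r_N,\bar r_N$ ($N=1,2,\ldots$) be the reflection coefficients of the weight $w(z)=(1+z)^{\mu}(1+1/z)^{\nu}e^{tz}$ on the unit circle, where $I^0_N[w]\neq0$ for each $N=1,2,\ldots$. Then $$r_N=(-1)^N\frac{(\nu)_N}{(\mu+1)_N}\,\frac{{}_1F_1^{(1)}(-\nu+1;N+1+\mu;t_1,\ldots,t_N)}{{}_1F_1^{(1)}(-\nu;N+\mu;t_1,\ldots,t_N)}\bigg|_{t_1=\cdots=t_N=-t},$$ $$\bar r_N=(-1)^N\frac{(\mu)_N}{(\nu+1)_N}\,\frac{{}_1F_1^{(1)}(-\nu-1;N-1+\mu;t_1,\ldots,t_N)}{{}_1F_1^{(1)}(-\nu;N+\mu;t_1,\ldots,t_N)}\bigg|_{t_1=\cdots=t_N=-t}.$$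
   Context: On the unit circle $z=e^{i\theta}$, $-\pi<\theta\le\pi$, the weight is $w(z)=z^{(\mu-\nu)/2}|1+z|^{\mu+\nu}e^{tz}$, with $z^{(\mu-\nu)/2}=e^{i\theta(\mu-\nu)/2}$. Its Fourier coefficients are $w_k=\frac1{2\pi}\int_{-\pi}^{\pi}w(e^{i\theta})e^{-ik\theta}\,d\theta$, $k\in\mathbb{Z}$. For $\epsilon\in\{0,1,-1\}$ put $I^\epsilon_N[w]=\det[w_{-\epsilon+j-k}]_{0\le j,k\le N-1}$. The reflection coefficients are $r_N=(-1)^N I^1_N[w]/I^0_N[w]$ and $\bar r_N=(-1)^N I^{-1}_N[w]/I^0_N[w]$; in general the bar does not mean complex conjugation. Write $(a)_l=a(a+1)\cdots(a+l-1)$. For a partition $\kappa=(\kappa_1\ge\cdots\ge\kappa_N\ge0)$ let $s_\kappa$ be the Schur polynomial, $[a]^{(1)}_\kappa=\prod_{j=1}^N(a-j+1)_{\kappa_j}$, and $h_\kappa=\prod_{(i,j)\in\kappa}[a(i,j)+l(i,j)+1]$ the product of hook lengths ($a(i,j),l(i,j)$ the arm and leg lengths of the node $(i,j)$ of the Young diagram of $\kappa$). The generalised hypergeometric function is $${}_pF_q^{(1)}(a_1,\ldots,a_p;b_1,\ldots,b_q;t_1,\ldots,t_N)=\sum_{\kappa}\frac{[a_1]^{(1)}_\kappa\cdots[a_p]^{(1)}_\kappa}{[b_1]^{(1)}_\kappa\cdots[b_q]^{(1)}_\kappa}\,\frac{s_\kappa(t_1,\ldots,t_N)}{h_\kappa},$$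 the sum being over all such partitions $\kappa$. *)

theory Defs
  imports "HOL-Analysis.Analysis" "Jordan_Normal_Form.Determinant"
begin

section \<open>Toeplitz determinants on the unit circle\<close>

text \<open>
  The principal argument takes values in \<open>(-pi, pi]\<close>, so \<open>Arg z\<close> is the angle \<open>\<theta>\<close>
  when \<open>z = exp (i \<theta>)\<close>. Only the values on the unit circle matter.
\<close>

definition weight :: "complex \<Rightarrow> complex \<Rightarrow> complex \<Rightarrow> complex \<Rightarrow> complex" where
  "weight \<mu> \<nu> t z =
     exp (\<i> * of_real (Arg z) * (\<mu> - \<nu>) / 2)
     * of_real (cmod (1 + z)) powr (\<mu> + \<nu>) * exp (t * z)"

text \<open>Away from \<open>z = -1\<close> this is the product form of the weight, with principal powers.\<close>

lemma weight_eq_product: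
  assumes z: "cmod z = 1" "z \<noteq> -1"
  shows "weight \<mu> \<nu> t z = (1 + z) powr \<mu> * (1 + 1 / z) powr \<nu> * exp (t * z)"
proof -
  define \<theta> where "\<theta> = Arg z"
  have z_eq: "z = cis \<theta>"
  proof -
    have "z \<noteq> 0" using z(1) by auto
    then have "cis (Arg z) = sgn z" by (rule cis_Arg)
    then show ?thesis using z(1) by (simp add: \<theta>_def sgn_eq)
  qed
  have "\<theta> \<noteq> pi" using z(2) z_eq by auto
  then have \<theta>: "-pi < \<theta>" "\<theta> < pi"
    using Arg_bounded[of z] by (auto simp: \<theta>_def)
  have cpos: "cos (\<theta> / 2) > 0" using \<theta> by (intro cos_gt_zero_pi) auto
  define r where "r = 2 * cos (\<theta> / 2)"
  have rpos: "r > 0" using cpos by (simp add: r_def)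
  have half: "cis \<theta> = cis (\<theta>/2) * cis (\<theta>/2)" by (simp add: cis_mult)
  have one: "1 = cis (\<theta>/2) * cis (-\<theta>/2)" by (simp add: cis_mult)
  have rr: "cis (-\<theta>/2) + cis (\<theta>/2) = of_real r"
    by (simp add: r_def complex_eq_iff)
  have A: "1 + z = of_real r * cis (\<theta>/2)"
  proof -
    have "1 + z = cis (\<theta>/2) * (cis (-\<theta>/2) + cis (\<theta>/2))"
      unfolding z_eq by (subst half, subst one) (simp only: distrib_left)
    then show ?thesis by (simp only: rr mult.commute)
  qed
  have B: "1 + 1 / z = of_real r * cis (-\<theta>/2)"
  proof -
    have "1 / z = cis (-\<theta>/2) * cis (-\<theta>/2)"
      unfolding z_eq cis_mult by (simp flip: inverse_eq_divide)
    moreover have "1 = cis (-\<theta>/2) * cis (\<theta>/2)" by (simp add: cis_mult)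
    ultimately have "1 + 1 / z = cis (-\<theta>/2) * cis (\<theta>/2) + cis (-\<theta>/2) * cis (-\<theta>/2)"
      by (rule arg_cong2[of _ _ _ _ "(+)", rotated])
    then have "1 + 1 / z = cis (-\<theta>/2) * (cis (-\<theta>/2) + cis (\<theta>/2))"
      by (simp only: distrib_left add.commute)
    then show ?thesis by (simp only: rr mult.commute)
  qed
  have normA: "cmod (1 + z) = r" using rpos by (simp add: A norm_mult)
  have ln_polar: "Ln (of_real r * cis x) = of_real (ln r) + \<i> * of_real x"
    if "-pi < x" "x < pi" for x
  proof (rule Ln_unique)
    have "exp (complex_of_real (ln r)) = of_real r"
      using rpos by (simp only: exp_of_real exp_ln)
    then show "exp (complex_of_real (ln r) + \<i> * of_real x) = of_real r * cis x"
      by (simp only: exp_add cis_conv_exp)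
  qed (use that in auto)
  have lnA: "Ln (1 + z) = of_real (ln r) + \<i> * of_real (\<theta>/2)"
    unfolding A using \<theta> by (intro ln_polar) auto
  have lnB: "Ln (1 + 1 / z) = of_real (ln r) + \<i> * of_real (-\<theta>/2)"
    unfolding B using \<theta> by (intro ln_polar) auto
  have nz: "1 + z \<noteq> 0" "1 + 1 / z \<noteq> 0" using rpos by (auto simp: A B)
  have "(1 + z) powr \<mu> * (1 + 1 / z) powr \<nu>
      = exp (\<i> * of_real \<theta> * (\<mu> - \<nu>) / 2 + (\<mu> + \<nu>) * of_real (ln r))"
  proof -
    have "(1 + z) powr \<mu> * (1 + 1 / z) powr \<nu> = exp (\<mu> * Ln (1 + z) + \<nu> * Ln (1 + 1 / z))"
      using nz by (simp only: powr_def if_False exp_add)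
    also have "\<mu> * Ln (1 + z) + \<nu> * Ln (1 + 1 / z)
        = \<i> * of_real \<theta> * (\<mu> - \<nu>) / 2 + (\<mu> + \<nu>) * of_real (ln r)"
      unfolding lnA lnB by (simp add: field_simps)
    finally show ?thesis .
  qed
  also have "\<dots> = exp (\<i> * of_real \<theta> * (\<mu> - \<nu>) / 2) * of_real r powr (\<mu> + \<nu>)"
    using rpos by (simp add: powr_def exp_add Ln_of_real)
  finally show ?thesis
    unfolding weight_def normA by (simp add: \<theta>_def)
qed

definition fourier_coeff :: "(complex \<Rightarrow> complex) \<Rightarrow> int \<Rightarrow> complex" where
  "fourier_coeff w k =
     1 / (2 * of_real pi) *
     (LBINT \<theta>:{-pi..pi}. w (cis \<theta>) * exp (- \<i> * of_int k * of_real \<theta>))"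

definition toeplitz_det :: "(complex \<Rightarrow> complex) \<Rightarrow> int \<Rightarrow> nat \<Rightarrow> complex" where
  "toeplitz_det w \<epsilon> N =
     Determinant.det (Matrix.mat N N (\<lambda>(j, k). fourier_coeff w (- \<epsilon> + int j - int k)))"

definition refl_coeff :: "(complex \<Rightarrow> complex) \<Rightarrow> nat \<Rightarrow> complex" where
  "refl_coeff w N = (-1) ^ N * toeplitz_det w 1 N / toeplitz_det w 0 N"

definition refl_coeff_bar :: "(complex \<Rightarrow> complex) \<Rightarrow> nat \<Rightarrow> complex" where
  "refl_coeff_bar w N = (-1) ^ N * toeplitz_det w (-1) N / toeplitz_det w 0 N"

section \<open>Partitions and Schur polynomials\<close>

text \<open>
  A partition with at most \<open>N\<close> parts is a weakly decreasing list of length exactly \<open>N\<close>,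
  padded with zeros. Rows, columns and variables are indexed from \<open>0\<close>.
\<close>

definition partitions :: "nat \<Rightarrow> nat list set" where
  "partitions N = {\<kappa>. length \<kappa> = N \<and> sorted_wrt (\<ge>) \<kappa>}"

definition diagram :: "nat list \<Rightarrow> (nat \<times> nat) set" where
  "diagram \<kappa> = {(i, j). i < length \<kappa> \<and> j < \<kappa> ! i}"

definition arm :: "nat list \<Rightarrow> nat \<times> nat \<Rightarrow> nat" where
  "arm \<kappa> = (\<lambda>(i, j). card {j'. j < j' \<and> (i, j') \<in> diagram \<kappa>})"

definition leg :: "nat list \<Rightarrow> nat \<times> nat \<Rightarrow> nat" where
  "leg \<kappa> = (\<lambda>(i, j). card {i'. i < i' \<and> (i', j) \<in> diagram \<kappa>})"

definition hook_prod :: "nat list \<Rightarrow> nat" where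
  "hook_prod \<kappa> = (\<Prod>c\<in>diagram \<kappa>. arm \<kappa> c + leg \<kappa> c + 1)"

text \<open>Semistandard Young tableaux of shape \<open>\<kappa>\<close> with entries in \<open>{0..<n}\<close>.\<close>

definition ssyt :: "nat list \<Rightarrow> nat \<Rightarrow> (nat \<times> nat \<Rightarrow> nat) set" where
  "ssyt \<kappa> n = {T \<in> diagram \<kappa> \<rightarrow>\<^sub>E {..<n}.
     (\<forall>i j j'. j < j' \<and> (i, j) \<in> diagram \<kappa> \<and> (i, j') \<in> diagram \<kappa> \<longrightarrow> T (i, j) \<le> T (i, j')) \<and>
     (\<forall>i i' j. i < i' \<and> (i, j) \<in> diagram \<kappa> \<and> (i', j) \<in> diagram \<kappa> \<longrightarrow> T (i, j) < T (i', j))}"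

text \<open>
  The quotient of alternants is \<open>0/0\<close> when variables coincide, so the Schur polynomial
  is given by its tableau definition.
\<close>

definition schur :: "nat list \<Rightarrow> complex list \<Rightarrow> complex" where
  "schur \<kappa> ts = (\<Sum>T\<in>ssyt \<kappa> (length ts). \<Prod>c\<in>diagram \<kappa>. ts ! T c)"

section \<open>Hypergeometric functions of several variables\<close>

definition gen_pochhammer :: "complex \<Rightarrow> nat list \<Rightarrow> complex" where
  "gen_pochhammer a \<kappa> = (\<Prod>j<length \<kappa>. pochhammer (a - of_nat j) (\<kappa> ! j))"

definition hypergeom :: "complex list \<Rightarrow> complex list \<Rightarrow> complex list \<Rightarrow> complex" where
  "hypergeom as bs ts =
     (\<Sum>\<^sub>\<infinity>\<kappa>\<in>partitions (length ts).
        (\<Prod>a\<leftarrow>as. gen_pochhammer a \<kappa>) / (\<Prod>b\<leftarrow>bs. gen_pochhammer b \<kappa>)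
        * (schur \<kappa> ts / of_nat (hook_prod \<kappa>)))"

end

theory Submission
  imports Defs
begin

text \<open>
  Expanding \<open>exp (t z)\<close> gives \<open>w\<^sub>n = (\<Sum>m. t ^ m / m! * a\<^sub>n\<^sub>-\<^sub>m)\<close> with \<open>a\<^sub>n\<close> the Fourier coefficients at \<open>t = 0\<close>;
  integration by parts yields a two-term recurrence which shows that \<open>a\<^sub>n\<close> is proportional to
  \<open>1 / (\<Gamma>(1 + \<mu> - n) \<Gamma>(1 + \<nu> + n))\<close>. So each Toeplitz matrix is a product of two infinite matrices, and the
  Cauchy--Binet formula writes its determinant as a sum over partitions \<open>\<kappa>\<close> of products of two minors with
  indices \<open>l\<^sub>i = \<kappa>\<^sub>i + N - 1 - i\<close>. Both minors are Vandermonde determinants in \<open>l\<close> times explicit products. By Weyl's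
  dimension formula and the hook length formula the squared Vandermonde determinant is the factor
  \<open>s\<^sub>\<kappa>(1,\<dots>,1) / h\<^sub>\<kappa>\<close> of the hypergeometric series. Shifting the index by \<open>\<epsilon>\<close> replaces \<open>(\<mu>, \<nu>)\<close> by
  \<open>(\<mu> + \<epsilon>, \<nu> - \<epsilon>)\<close>, and all constants that depend only on \<open>\<mu> + \<nu>\<close> cancel in the ratios.
\<close>

section \<open>Determinants\<close>

text \<open>The coefficients at \<open>t = 0\<close> can vanish for special parameters, so they are
  expressed through the entire function \<open>rGamma\<close>: lowering its argument only multiplies
  by a polynomial, and identities stay valid at the poles of Gamma. A division first appears on
  comparison with the empty partition, and there a condition on \<mu> enters. The series of the
  exponential goes into the right-hand matrix, with entries t^(l-k)/(l-k)!, so the shift \<epsilon>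
  touches only the left-hand one. Comparing different \<epsilon> then reduces to comparing products
  of reciprocal Gamma values. The normalising constants are obtained by existence statements and
  never evaluated. What matters is the order of the quantifiers: each is fixed before \<kappa> and
  \<epsilon>, so together they form a single factor of all three Toeplitz determinants. The argument
  -t of the series arises when falling products in \<nu> are rewritten as Pochhammer symbols of
  -\<nu>.\<close>

lemma det_mat_cols:
  fixes f :: "nat \<Rightarrow> nat \<Rightarrow> 'a :: comm_ring_1"
  shows "Determinant.det (Matrix.mat n n (\<lambda>(i, j). f i j)) =
    (\<Sum>p | p permutes {0..<n}. of_int (sign p) * (\<Prod>j<n. f (p j) j))"
proof -
  have "(\<Prod>j<n. Matrix.mat n n (\<lambda>(i, j). f i j) $$ (p j, j)) = (\<Prod>j<n. f (p j) j)"
    if "p permutes {0..<n}" for p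
    using permutes_in_image[OF that] by (intro prod.cong) auto
  then show ?thesis
    by (subst det_col[of _ n]) (auto intro!: sum.cong)
qed

lemma det_mat_transpose:
  fixes f :: "nat \<Rightarrow> nat \<Rightarrow> 'a :: comm_ring_1"
  shows "Determinant.det (Matrix.mat n n (\<lambda>(i, j). f j i)) = Determinant.det (Matrix.mat n n (\<lambda>(i, j). f i j))"
  by (subst det_transpose[symmetric, of _ n]) (auto intro!: arg_cong[where f = Determinant.det])

lemma det_mat_permute_cols:
  fixes f :: "nat \<Rightarrow> nat \<Rightarrow> 'a :: comm_ring_1"
  assumes p: "p permutes {0..<n}"
  shows "Determinant.det (Matrix.mat n n (\<lambda>(i, j). f i (p j))) =
    of_int (sign p) * Determinant.det (Matrix.mat n n (\<lambda>(i, j). f i j))"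
proof -
  let ?T = "\<lambda>f. Matrix.mat n n (\<lambda>(i, j). f j i)"
  have "Determinant.det (Matrix.mat n n (\<lambda>(i, j). f i (p j)))
      = Determinant.det (Matrix.mat n n (\<lambda>(i, j). ?T f $$ (p i, j)))"
    using permutes_in_image[OF p]
    by (subst det_mat_transpose[of n "\<lambda>j i. f i (p j)"])
      (intro arg_cong[where f = Determinant.det] eq_matI; simp)
  also have "\<dots> = of_int (sign p) * Determinant.det (?T f)"
    by (rule det_permute_rows[OF _ p]) simp
  also have "Determinant.det (?T f) = Determinant.det (Matrix.mat n n (\<lambda>(i, j). f i j))"
    by (rule det_mat_transpose)
  finally show ?thesis .
qed

lemma det_mat_noninj_cols:
  fixes f :: "nat \<Rightarrow> 'b \<Rightarrow> 'a :: comm_ring_1"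
  assumes "\<not> inj_on l {0..<n}"
  shows "Determinant.det (Matrix.mat n n (\<lambda>(i, j). f i (l j))) = 0"
proof -
  obtain i j where "i < n" "j < n" "i \<noteq> j" "l i = l j"
    using assms by (auto simp: inj_on_def)
  then show ?thesis
    by (intro det_identical_columns[of _ n i j]) (auto intro!: eq_vecI)
qed

lemma det_mat_scale_cols:
  fixes f :: "nat \<Rightarrow> nat \<Rightarrow> 'a :: comm_ring_1"
  shows "Determinant.det (Matrix.mat n n (\<lambda>(i, j). c j * f i j)) =
    (\<Prod>j<n. c j) * Determinant.det (Matrix.mat n n (\<lambda>(i, j). f i j))"
  unfolding det_mat_cols by (simp add: prod.distrib sum_distrib_left mult_ac)

text \<open>Expanding in monomials factors the matrix into coefficients times powers; the degree
  bound makes both factors square. The coefficient determinant does not depend on the points, which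
  later makes it a constant.\<close>

lemma det_mat_poly:
  fixes p :: "nat \<Rightarrow> 'a :: comm_ring_1 poly" and x :: "nat \<Rightarrow> 'a"
  assumes "\<And>i. i < n \<Longrightarrow> degree (p i) < n"
  shows "Determinant.det (Matrix.mat n n (\<lambda>(i, j). poly (p i) (x j))) =
    Determinant.det (Matrix.mat n n (\<lambda>(i, k). coeff (p i) k)) *
    Determinant.det (Matrix.mat n n (\<lambda>(k, j). x j ^ k))"
proof -
  have "poly (p i) (x j) = (\<Sum>k<n. coeff (p i) k * x j ^ k)" if "i < n" for i j
  proof -
    have "poly (p i) (x j) = (\<Sum>k\<le>degree (p i). coeff (p i) k * x j ^ k)"
      by (rule poly_altdef)
    also have "\<dots> = (\<Sum>k<n. coeff (p i) k * x j ^ k)"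
      using assms[OF that] by (intro sum.mono_neutral_left) (auto simp: coeff_eq_0)
    finally show ?thesis .
  qed
  then have "Matrix.mat n n (\<lambda>(i, j). poly (p i) (x j)) =
      Matrix.mat n n (\<lambda>(i, k). coeff (p i) k) * Matrix.mat n n (\<lambda>(k, j). x j ^ k)"
    by (intro eq_matI) (auto simp: scalar_prod_def atLeast0LessThan)
  then show ?thesis by (simp add: det_mult[of _ n])
qed

lemma det_mat_monic_poly:
  fixes p :: "nat \<Rightarrow> 'a :: comm_ring_1 poly" and x :: "nat \<Rightarrow> 'a"
  assumes "\<And>i. i < n \<Longrightarrow> degree (p i) = i" and "\<And>i. i < n \<Longrightarrow> lead_coeff (p i) = 1"
  shows "Determinant.det (Matrix.mat n n (\<lambda>(i, j). poly (p i) (x j))) =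
    Determinant.det (Matrix.mat n n (\<lambda>(k, j). x j ^ k))"
proof -
  have "Determinant.det (Matrix.mat n n (\<lambda>(i, k). coeff (p i) k)) =
      prod_list (diag_mat (Matrix.mat n n (\<lambda>(i, k). coeff (p i) k)))"
    using assms(1) by (intro det_lower_triangular[of n]) (auto simp: coeff_eq_0)
  also have "\<dots> = 1"
    using assms by (auto simp: prod_list_diag_prod intro!: prod.neutral)
  finally show ?thesis using assms(1) by (subst det_mat_poly) auto
qed

text \<open>Each factor is the later point minus the earlier one, so at strictly decreasing points
  every factor is negative.\<close>

definition vdm :: "nat \<Rightarrow> (nat \<Rightarrow> 'a :: comm_ring_1) \<Rightarrow> 'a" where
  "vdm n x = (\<Prod>j<n. \<Prod>i<j. x j - x i)"

text \<open>The Newton basis makes the matrix triangular.\<close>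

lemma det_vandermonde:
  fixes x :: "nat \<Rightarrow> 'a :: idom"
  shows "Determinant.det (Matrix.mat n n (\<lambda>(k, j). x j ^ k)) = vdm n x"
proof -
  define p where "p k = (\<Prod>m<k. [:- x m, 1:])" for k
  have deg: "degree (p k) = k" and lead: "lead_coeff (p k) = 1" for k
  proof -
    show "degree (p k) = k" unfolding p_def
      by (subst degree_prod_sum_eq) auto
    show "lead_coeff (p k) = 1" unfolding p_def by (simp add: lead_coeff_prod)
  qed
  have poly_p: "poly (p k) y = (\<Prod>m<k. y - x m)" for k y
    by (simp add: p_def poly_prod)
  have "Determinant.det (Matrix.mat n n (\<lambda>(k, j). x j ^ k)) =
      Determinant.det (Matrix.mat n n (\<lambda>(i, j). poly (p i) (x j)))"
    by (rule det_mat_monic_poly[symmetric]) (use deg lead in auto)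
  also have "\<dots> = prod_list (diag_mat (Matrix.mat n n (\<lambda>(i, j). poly (p i) (x j))))"
    by (intro det_upper_triangular[of _ n] upper_triangularI) (auto simp: poly_p)
  also have "\<dots> = vdm n x"
    by (simp add: prod_list_diag_prod poly_p vdm_def atLeast0LessThan)
  finally show ?thesis .
qed

lemma det_mat_monic_poly_vdm:
  fixes p :: "nat \<Rightarrow> 'a :: idom poly"
  assumes "\<And>i. i < n \<Longrightarrow> degree (p i) = i" and "\<And>i. i < n \<Longrightarrow> lead_coeff (p i) = 1"
  shows "Determinant.det (Matrix.mat n n (\<lambda>(i, j). poly (p i) (x j))) = vdm n x"
  using det_mat_monic_poly[OF assms] by (simp add: det_vandermonde)

text \<open>Falling factorials form a monic basis. They are the common core of binomial coefficients
  and of the quotients l!/(l-k)!, so this evaluation serves both the tableau count and the minors of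
  the exponential series.\<close>

lemma det_falling:
  fixes x :: "nat \<Rightarrow> 'a :: idom"
  shows "Determinant.det (Matrix.mat n n (\<lambda>(k, j). \<Prod>m<k. x j - of_nat m)) = vdm n x"
proof -
  define p :: "nat \<Rightarrow> 'a poly" where "p k = (\<Prod>m<k. [:- of_nat m, 1:])" for k
  have "degree (p k) = k" for k
    unfolding p_def by (subst degree_prod_sum_eq) auto
  moreover have "lead_coeff (p k) = 1" for k
    unfolding p_def by (simp add: lead_coeff_prod)
  moreover have "poly (p k) y = (\<Prod>m<k. y - of_nat m)" for k y
    by (simp add: p_def poly_prod)
  ultimately show ?thesis using det_mat_monic_poly_vdm[of n p x] by simp
qed

section \<open>Cauchy--Binet for infinite sums\<close>

text \<open>These are the beta numbers of the padded partition: adding the staircase N-1, ..., 1, 0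
  turns weakly decreasing sequences into strictly decreasing ones.\<close>

definition shifted_part :: "nat list \<Rightarrow> nat \<Rightarrow> nat" where
  "shifted_part \<kappa> i = \<kappa> ! i + (length \<kappa> - 1 - i)"

lemma shifted_part_less:
  assumes "\<kappa> \<in> partitions N" "i < j" "j < N"
  shows "shifted_part \<kappa> j < shifted_part \<kappa> i"
proof -
  have "length \<kappa> = N" "\<kappa> ! j \<le> \<kappa> ! i"
    using assms by (auto simp: partitions_def sorted_wrt_iff_nth_less)
  then show ?thesis using assms by (simp add: shifted_part_def)
qed

lemma shifted_part_less_iff:
  assumes "\<kappa> \<in> partitions N" "i < N" "j < N"
  shows "shifted_part \<kappa> j < shifted_part \<kappa> i \<longleftrightarrow> i < j"
  using shifted_part_less[OF assms(1), of i j] shifted_part_less[OF assms(1), of j i] assms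
  by (cases i j rule: linorder_cases) auto

lemma inj_on_shifted_part:
  assumes "\<kappa> \<in> partitions N"
  shows "inj_on (shifted_part \<kappa>) {0..<N}"
proof (rule inj_onI)
  fix i j assume "i \<in> {0..<N}" "j \<in> {0..<N}" "shifted_part \<kappa> i = shifted_part \<kappa> j"
  then show "i = j"
    using shifted_part_less_iff[OF assms, of i j] shifted_part_less_iff[OF assms, of j i]
    by (cases i j rule: linorder_cases) auto
qed

lemma shifted_part_inject:
  assumes "\<kappa> \<in> partitions N" "\<kappa>' \<in> partitions N"
    and "\<And>i. i < N \<Longrightarrow> shifted_part \<kappa> i = shifted_part \<kappa>' i"
  shows "\<kappa> = \<kappa>'"
proof (rule nth_equalityI)
  show "length \<kappa> = length \<kappa>'" using assms by (simp add: partitions_def)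
  show "\<kappa> ! i = \<kappa>' ! i" if "i < length \<kappa>" for i
    using assms(1,2) assms(3)[of i] that by (simp add: partitions_def shifted_part_def)
qed

text \<open>The value \<open>p i\<close> is its own rank, so a permutation can be recovered from the
  relative order of its values. This gives uniqueness of the permutation that sorts an injective
  tuple.\<close>

lemma card_less_permutes:
  assumes p: "p permutes {0..<N}" and i: "i < N"
  shows "card {j. j < N \<and> p j < p i} = p i"
proof -
  have "p ` {j. j < N \<and> p j < p i} = {..<p i}"
  proof safe
    fix x assume x: "x < p i"
    have "p i < N" using permutes_in_image[OF p, of i] i by simp
    with x have "x \<in> p ` {0..<N}" using permutes_image[OF p] by simp
    then obtain j where "j < N" "x = p j" by auto
    with x show "x \<in> p ` {j. j < N \<and> p j < p i}" by auto
  qed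
  moreover have "inj_on p {j. j < N \<and> p j < p i}"
    using permutes_inj[OF p] by (rule inj_on_subset) auto
  ultimately show ?thesis
    by (metis card_image card_lessThan)
qed

text \<open>Strictly decreasing natural numbers drop by at least one per step, so \<open>m i\<close>
  is at least \<open>N - 1 - i\<close> and the truncated subtraction of the staircase is
  exact.\<close>

lemma strict_decreasing_shifted_part:
  fixes m :: "nat \<Rightarrow> nat"
  assumes m: "\<And>i j. i < j \<Longrightarrow> j < N \<Longrightarrow> m j < m i"
  obtains \<kappa> where "\<kappa> \<in> partitions N" "\<And>i. i < N \<Longrightarrow> shifted_part \<kappa> i = m i"
proof -
  have gap: "m (i + d) + d \<le> m i" if "i + d < N" for i d
    using that
  proof (induction d)
    case (Suc d)
    then show ?case using m[of "i + d" "i + Suc d"] by simp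
  qed simp
  have ge: "N - 1 - i \<le> m i" if "i < N" for i
    using gap[of i "N - 1 - i"] that by simp
  define \<kappa> where "\<kappa> = map (\<lambda>i. m i - (N - 1 - i)) [0..<N]"
  have "\<kappa> ! j \<le> \<kappa> ! i" if "i < j" "j < N" for i j
    using gap[of i "j - i"] ge[of i] ge[of j] that by (simp add: \<kappa>_def)
  then have "\<kappa> \<in> partitions N"
    by (auto simp: partitions_def sorted_wrt_iff_nth_less \<kappa>_def)
  moreover have "shifted_part \<kappa> i = m i" if "i < N" for i
    using ge[OF that] that by (simp add: \<kappa>_def shifted_part_def)
  ultimately show ?thesis using that by blast
qed

text \<open>An injective tuple is a strictly decreasing one, i.e. a partition, with its entries permuted.\<close>

lemma bij_betw_partitions_permutes:
  "bij_betw (\<lambda>(\<kappa>, p). restrict (shifted_part \<kappa> \<circ> p) {0..<N})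
     (partitions N \<times> {p. p permutes {0..<N}}) {l \<in> {0..<N} \<rightarrow>\<^sub>E UNIV. inj_on l {0..<N}}"
    (is "bij_betw ?f ?A ?B")
  unfolding bij_betw_def
proof (intro conjI inj_onI)
  fix x y assume x: "x \<in> ?A" and y: "y \<in> ?A" and eq: "?f x = ?f y"
  obtain \<kappa> p \<kappa>' p' where xy: "x = (\<kappa>, p)" "y = (\<kappa>', p')" by (cases x, cases y)
  have \<kappa>: "\<kappa> \<in> partitions N" "\<kappa>' \<in> partitions N"
    and p: "p permutes {0..<N}" "p' permutes {0..<N}" using x y xy by auto
  have eq': "shifted_part \<kappa> (p i) = shifted_part \<kappa>' (p' i)" if "i < N" for i
    using fun_cong[OF eq, of i] that by (simp add: xy)
  have lt: "p i < N" "p' i < N" if "i < N" for i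
    using permutes_in_image[OF p(1), of i] permutes_in_image[OF p(2), of i] that by auto
  have "p i = p' i" if i: "i < N" for i
  proof -
    have "p j < p i \<longleftrightarrow> p' j < p' i" if "j < N" for j
      using shifted_part_less_iff[OF \<kappa>(1), of "p j" "p i"] shifted_part_less_iff[OF \<kappa>(2), of "p' j" "p' i"]
        eq'[OF i] eq'[OF that] lt[OF i] lt[OF that] by simp
    then have "{j. j < N \<and> p j < p i} = {j. j < N \<and> p' j < p' i}" by auto
    then show ?thesis
      using card_less_permutes[OF p(1) i] card_less_permutes[OF p(2) i] by simp
  qed
  moreover have "p i = p' i" if "\<not> i < N" for i
    using that p by (simp add: permutes_def)
  ultimately have pp: "p = p'" by blast
  have "\<kappa> = \<kappa>'"
  proof (rule shifted_part_inject[OF \<kappa>])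
    fix i assume "i < N"
    then have "i \<in> p ` {0..<N}" using permutes_image[OF p(1)] by simp
    then obtain j where "j < N" "i = p j" by auto
    then show "shifted_part \<kappa> i = shifted_part \<kappa>' i" using eq' pp by simp
  qed
  with pp show "x = y" by (simp add: xy)
next
  show "?f ` ?A = ?B"
  proof (intro equalityI subsetI)
    fix x assume "x \<in> ?f ` ?A"
    then obtain \<kappa> p where \<kappa>: "\<kappa> \<in> partitions N" and p: "p permutes {0..<N}"
      and x: "x = restrict (shifted_part \<kappa> \<circ> p) {0..<N}" by auto
    have "inj_on (shifted_part \<kappa> \<circ> p) {0..<N}"
      using inj_on_shifted_part[OF \<kappa>] p
      by (intro comp_inj_on) (auto simp: permutes_image permutes_inj_on)
    then show "x \<in> ?B" unfolding x by (simp add: inj_on_def)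
  next
    fix l assume "l \<in> ?B"
    then have l: "l \<in> {0..<N} \<rightarrow>\<^sub>E UNIV" "inj_on l {0..<N}" by auto
    \<comment> \<open>The position of \<open>l i\<close> when the tuple is sorted into decreasing
      order.\<close>
    define p where "p i = (if i < N then card {j. j < N \<and> l i < l j} else i)" for i
    have p_less: "p i < p j" if "i < N" "j < N" "l j < l i" for i j
      unfolding p_def using that by (auto intro!: psubset_card_mono)
    have p: "p permutes {0..<N}"
    proof (rule inj_on_nat_permutes)
      show "inj_on p {0..<N}"
      proof (rule inj_onI)
        fix i j assume ij: "i \<in> {0..<N}" "j \<in> {0..<N}" "p i = p j"
        then have "l i = l j"
          using p_less[of i j] p_less[of j i] by (cases "l i" "l j" rule: linorder_cases) auto
        then show "i = j" using l(2) ij by (auto dest: inj_onD)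
      qed
      show "p \<in> {0..<N} \<rightarrow> {0..<N}"
      proof
        fix i assume i: "i \<in> {0..<N}"
        have "card {j. j < N \<and> l i < l j} \<le> card ({0..<N} - {i})"
          by (intro card_mono) auto
        also have "\<dots> < N" using i by simp
        finally show "p i \<in> {0..<N}" using i by (simp add: p_def)
      qed
    qed (auto simp: p_def)
    define q where "q = Hilbert_Choice.inv p"
    have q: "q permutes {0..<N}" "p (q i) = i" "q (p i) = i" for i
      using permutes_inv[OF p] permutes_inverses[OF p] by (auto simp: q_def)
    obtain \<kappa> where \<kappa>: "\<kappa> \<in> partitions N" "\<And>i. i < N \<Longrightarrow> shifted_part \<kappa> i = l (q i)"
    proof (rule strict_decreasing_shifted_part[of N "\<lambda>i. l (q i)"])
      fix i j assume ij: "i < j" "j < N"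
      have qlt: "q i < N" "q j < N"
        using permutes_in_image[OF q(1)] ij by auto
      have "q i \<noteq> q j" using ij q(2) by (metis less_irrefl)
      then have "l (q i) \<noteq> l (q j)" using l(2) qlt by (auto dest: inj_onD)
      moreover have "\<not> l (q i) < l (q j)"
        using p_less[of "q j" "q i"] qlt ij q(2) by auto
      ultimately show "l (q j) < l (q i)" by simp
    qed blast
    have "l = ?f (\<kappa>, p)"
    proof
      fix i show "l i = ?f (\<kappa>, p) i"
      proof (cases "i < N")
        case True
        then have "p i < N" using permutes_in_image[OF p, of i] by simp
        then show ?thesis using \<kappa>(2)[of "p i"] q(3) True by simp
      qed (use l(1) in \<open>auto simp: PiE_def extensional_def\<close>)
    qed
    then show "l \<in> ?f ` ?A" using \<kappa>(1) p by blast
  qed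
qed

text \<open>Absolute convergence permits multiplying out a finite product of series into one sum
  over all choice functions. Summability is transferred between the two notions of
  \<open>abs_summable_on\<close>.\<close>

lemma has_sum_prod_PiE:
  fixes f :: "'a \<Rightarrow> nat \<Rightarrow> complex"
  assumes "finite A" "\<And>x. x \<in> A \<Longrightarrow> Infinite_Sum.abs_summable_on (f x) UNIV"
  shows "((\<lambda>g. \<Prod>x\<in>A. f x (g x)) has_sum (\<Prod>x\<in>A. infsum (f x) UNIV)) (A \<rightarrow>\<^sub>E UNIV)"
proof -
  have "Infinite_Set_Sum.abs_summable_on (\<lambda>g. \<Prod>x\<in>A. f x (g x)) (A \<rightarrow>\<^sub>E UNIV)"
    using assms by (intro abs_summable_on_prod_PiE abs_summable_equivalent[THEN iffD1]) auto
  then have "(\<lambda>g. \<Prod>x\<in>A. f x (g x)) summable_on (A \<rightarrow>\<^sub>E UNIV)"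
    by (rule abs_summable_summable[OF abs_summable_equivalent[THEN iffD2]])
  then show ?thesis
    using infsum_prod_PiE_abs[of A f "\<lambda>_. UNIV"] assms by (simp add: has_sum_iff)
qed

lemma has_sum_sum:
  fixes f :: "'a \<Rightarrow> 'b \<Rightarrow> 'c :: topological_comm_monoid_add"
  assumes "finite I" "\<And>i. i \<in> I \<Longrightarrow> (f i has_sum S i) A"
  shows "((\<lambda>x. \<Sum>i\<in>I. f i x) has_sum (\<Sum>i\<in>I. S i)) A"
  using assms by (induction I rule: finite_induct) (auto intro!: has_sum_add)

text \<open>Multiplying out the Leibniz formula gives a sum over all index tuples \<open>l\<close>,
  each contributing a minor of \<open>B\<close> times one product of entries of \<open>E\<close>.
  Tuples with a repeated index vanish. The others are grouped by their decreasing rearrangement, and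
  the sum over the rearrangements produces the minor of \<open>E\<close>.\<close>

theorem cauchy_binet_has_sum:
  fixes B E :: "nat \<Rightarrow> nat \<Rightarrow> complex"
  assumes summable: "\<And>j k. j < N \<Longrightarrow> k < N \<Longrightarrow> Infinite_Sum.abs_summable_on (\<lambda>l. B j l * E l k) UNIV"
  shows "((\<lambda>\<kappa>. Determinant.det (Matrix.mat N N (\<lambda>(j, k). B j (shifted_part \<kappa> k))) *
              Determinant.det (Matrix.mat N N (\<lambda>(i, k). E (shifted_part \<kappa> i) k)))
          has_sum Determinant.det (Matrix.mat N N (\<lambda>(j, k). \<Sum>\<^sub>\<infinity>l. B j l * E l k))) (partitions N)"
proof -
  let ?D = "Determinant.det (Matrix.mat N N (\<lambda>(j, k). \<Sum>\<^sub>\<infinity>l. B j l * E l k))"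
  let ?dB = "\<lambda>l. Determinant.det (Matrix.mat N N (\<lambda>(j, k). B j (l k)))"
  let ?P = "{p. p permutes {0..<N}}"
  define F where "F l = ?dB l * (\<Prod>k<N. E (l k) k)" for l
  have "((\<lambda>l. \<Sum>p\<in>?P. of_int (sign p) * (\<Prod>k\<in>{0..<N}. B (p k) (l k) * E (l k) k)) has_sum
      (\<Sum>p\<in>?P. of_int (sign p) * (\<Prod>k\<in>{0..<N}. \<Sum>\<^sub>\<infinity>l. B (p k) l * E l k)))
      ({0..<N} \<rightarrow>\<^sub>E UNIV)"
  proof (intro has_sum_sum has_sum_cmult_right has_sum_prod_PiE)
    fix p k assume "p \<in> ?P" "k \<in> {0..<N}"
    then show "Infinite_Sum.abs_summable_on (\<lambda>l. B (p k) l * E l k) UNIV"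
      using permutes_in_image[of p "{0..<N}" k] by (intro summable) auto
  qed (auto simp: finite_permutations)
  moreover have "(\<Sum>p\<in>?P. of_int (sign p) * (\<Prod>k\<in>{0..<N}. B (p k) (l k) * E (l k) k)) = F l" for l
    unfolding F_def det_mat_cols sum_distrib_right
    by (simp add: prod.distrib atLeast0LessThan mult_ac)
  moreover have "(\<Sum>p\<in>?P. of_int (sign p) * (\<Prod>k\<in>{0..<N}. \<Sum>\<^sub>\<infinity>l. B (p k) l * E l k)) = ?D"
    unfolding det_mat_cols by (simp add: atLeast0LessThan)
  ultimately have "(F has_sum ?D) ({0..<N} \<rightarrow>\<^sub>E UNIV)" by simp
  moreover have "F l = 0" if "\<not> inj_on l {0..<N}" for l
    using det_mat_noninj_cols[OF that, of B] by (simp add: F_def)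
  ultimately have "(F has_sum ?D) {l \<in> {0..<N} \<rightarrow>\<^sub>E UNIV. inj_on l {0..<N}}"
    by (elim has_sum_cong_neutral[THEN iffD1, rotated 3]) auto
  then have "((\<lambda>x. F (case x of (\<kappa>, p) \<Rightarrow> restrict (shifted_part \<kappa> \<circ> p) {0..<N})) has_sum ?D)
      (partitions N \<times> ?P)"
    by (subst has_sum_reindex_bij_betw[OF bij_betw_partitions_permutes])
  then have S: "((\<lambda>(\<kappa>, p). F (restrict (shifted_part \<kappa> \<circ> p) {0..<N})) has_sum ?D) (Sigma (partitions N) (\<lambda>_. ?P))"
    by (simp add: case_prod_unfold)
  have inner: "(\<Sum>p\<in>?P. F (restrict (shifted_part \<kappa> \<circ> p) {0..<N})) =
      ?dB (shifted_part \<kappa>) * Determinant.det (Matrix.mat N N (\<lambda>(i, k). E (shifted_part \<kappa> i) k))" for \<kappa>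
  proof -
    \<comment> \<open>Sorting the columns of the minor of \<open>B\<close> costs
      \<open>sign p\<close>, which is the sign that the Leibniz expansion of the minor of
      \<open>E\<close> requires.\<close>
    have "F (restrict (shifted_part \<kappa> \<circ> p) {0..<N}) =
        ?dB (shifted_part \<kappa>) * (of_int (sign p) * (\<Prod>k<N. E (shifted_part \<kappa> (p k)) k))"
      if p: "p permutes {0..<N}" for p
    proof -
      have "Matrix.mat N N (\<lambda>(j, k). B j (restrict (shifted_part \<kappa> \<circ> p) {0..<N} k)) =
          Matrix.mat N N (\<lambda>(j, k). B j (shifted_part \<kappa> (p k)))" by (intro eq_matI) auto
      then show ?thesis
        using det_mat_permute_cols[OF p, of "\<lambda>j k. B j (shifted_part \<kappa> k)"] by (simp add: F_def)
    qed
    then show ?thesis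
      by (simp add: det_mat_cols[of N "\<lambda>i k. E (shifted_part \<kappa> i) k"] sum_distrib_left)
  qed
  show ?thesis
    by (rule has_sum_SigmaD[OF S]) (simp add: inner[symmetric] has_sum_finiteI finite_permutations)
qed

section \<open>Hook lengths\<close>

lemma diagram_eq_Sigma: "diagram \<kappa> = Sigma {..<length \<kappa>} (\<lambda>i. {..<\<kappa> ! i})"
  by (auto simp: diagram_def)

lemma finite_diagram [simp]: "finite (diagram \<kappa>)"
  by (simp add: diagram_eq_Sigma)

lemma card_diagram: "card (diagram \<kappa>) = sum_list \<kappa>"
  by (simp add: diagram_eq_Sigma sum_list_sum_nth atLeast0LessThan)

lemma partitions_nth_mono:
  "\<kappa> \<in> partitions N \<Longrightarrow> i \<le> j \<Longrightarrow> j < N \<Longrightarrow> \<kappa> ! j \<le> \<kappa> ! i"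
  by (cases "i = j") (auto simp: partitions_def sorted_wrt_iff_nth_less)

text \<open>The hook lengths of row \<open>i\<close> and the differences \<open>l\<^sub>i - l\<^sub>i\<^sub>'\<close> with \<open>i' > i\<close> partition \<open>{1..l\<^sub>i}\<close>.\<close>

lemma hook_row_prod:
  assumes \<kappa>: "\<kappa> \<in> partitions N" and i: "i < N"
  shows "(\<Prod>j<\<kappa> ! i. arm \<kappa> (i, j) + leg \<kappa> (i, j) + 1) *
      (\<Prod>i'\<in>{i<..<N}. shifted_part \<kappa> i - shifted_part \<kappa> i') = fact (shifted_part \<kappa> i)"
proof -
  have len: "length \<kappa> = N" using \<kappa> by (simp add: partitions_def)
  define h where "h j = arm \<kappa> (i, j) + leg \<kappa> (i, j) + 1" for j
  define d where "d i' = shifted_part \<kappa> i - shifted_part \<kappa> i'" for i'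
  have arm: "arm \<kappa> (i, j) = \<kappa> ! i - Suc j" for j
  proof -
    have "{j'. j < j' \<and> (i, j') \<in> diagram \<kappa>} = {j<..<\<kappa> ! i}"
      using i len by (auto simp: diagram_def)
    then show ?thesis by (simp add: arm_def)
  qed
  have leg: "leg \<kappa> (i, j) = card {i' \<in> {i<..<N}. j < \<kappa> ! i'}" for j
  proof -
    have "{i'. i < i' \<and> (i', j) \<in> diagram \<kappa>} = {i' \<in> {i<..<N}. j < \<kappa> ! i'}"
      using i len by (auto simp: diagram_def)
    then show ?thesis by (simp add: leg_def)
  qed
  have leg_mono: "leg \<kappa> (i, j') \<le> leg \<kappa> (i, j)" if "j \<le> j'" for j j'
    unfolding leg using that by (intro card_mono) auto
  have leg_le: "leg \<kappa> (i, j) \<le> N - 1 - i" for j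
  proof -
    have "leg \<kappa> (i, j) \<le> card {i<..<N}" unfolding leg by (intro card_mono) auto
    then show ?thesis by simp
  qed
  have leg_ge': "i' - i \<le> leg \<kappa> (i, j)" if "i < i'" "i' < N" "j < \<kappa> ! i'" for i' j
  proof -
    have "{i<..i'} \<subseteq> {i' \<in> {i<..<N}. j < \<kappa> ! i'}"
      using that partitions_nth_mono[OF \<kappa>, of _ i'] by force
    then have "card {i<..i'} \<le> leg \<kappa> (i, j)" unfolding leg by (intro card_mono) auto
    then show ?thesis by simp
  qed
  have leg_le': "leg \<kappa> (i, j) < i' - i" if "i < i'" "i' < N" "\<kappa> ! i' \<le> j" for i' j
  proof -
    have "k < i'" if "k \<in> {i<..<N}" "j < \<kappa> ! k" for k
      using that \<open>\<kappa> ! i' \<le> j\<close> partitions_nth_mono[OF \<kappa>, of i' k] by (cases "i' \<le> k") auto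
    then have "{i' \<in> {i<..<N}. j < \<kappa> ! i'} \<subseteq> {i<..<i'}" by auto
    then have "leg \<kappa> (i, j) \<le> card {i<..<i'}" unfolding leg by (intro card_mono) auto
    then show ?thesis using that by simp
  qed
  have d: "d i' = \<kappa> ! i - \<kappa> ! i' + (i' - i)" and d_le: "\<kappa> ! i' \<le> \<kappa> ! i" if "i < i'" "i' < N" for i'
    using partitions_nth_mono[OF \<kappa>, of i i'] that len by (auto simp: d_def shifted_part_def)
  have h: "h j = \<kappa> ! i - j + leg \<kappa> (i, j)" if "j < \<kappa> ! i" for j
    using that by (simp add: h_def arm)
  have inj_h: "inj_on h {..<\<kappa> ! i}"
  proof (rule inj_onI)
    fix j j' assume "j \<in> {..<\<kappa> ! i}" "j' \<in> {..<\<kappa> ! i}" "h j = h j'"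
    then show "j = j'"
      using leg_mono[of j j'] leg_mono[of j' j] by (cases j j' rule: linorder_cases) (auto simp: h)
  qed
  have inj_d: "inj_on d {i<..<N}"
  proof (rule inj_onI)
    fix a b assume ab: "a \<in> {i<..<N}" "b \<in> {i<..<N}" "d a = d b"
    then show "a = b"
      using partitions_nth_mono[OF \<kappa>, of a b] partitions_nth_mono[OF \<kappa>, of b a] d_le[of a] d_le[of b]
      by (cases a b rule: linorder_cases) (auto simp: d)
  qed
  \<comment> \<open>If row \<open>i'\<close> reaches past column \<open>j\<close>, then so do all
    rows from \<open>i\<close> to \<open>i'\<close>, and \<open>h j > d i'\<close>. If it does not,
    only rows before \<open>i'\<close> can count in the leg, and \<open>h j < d i'\<close>.\<close>
  have disj: "h ` {..<\<kappa> ! i} \<inter> d ` {i<..<N} = {}"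
  proof -
    have "h j \<noteq> d i'" if "j < \<kappa> ! i" "i < i'" "i' < N" for j i'
      using leg_ge'[of i' j] leg_le'[of i' j] that d_le[of i']
      by (cases "j < \<kappa> ! i'") (auto simp: h d)
    then show ?thesis by auto
  qed
  \<comment> \<open>All values lie in the interval, so a count suffices: \<open>\<kappa> ! i\<close>
    cells and \<open>N - 1 - i\<close> later rows add up to
    \<open>shifted_part \<kappa> i\<close>.\<close>
  have "h ` {..<\<kappa> ! i} \<union> d ` {i<..<N} = {1..shifted_part \<kappa> i}"
  proof (rule card_subset_eq)
    have "1 \<le> h j \<and> h j \<le> shifted_part \<kappa> i" if "j < \<kappa> ! i" for j
      using leg_le[of j] that len by (simp add: h shifted_part_def) linarith
    moreover have "1 \<le> d i' \<and> d i' \<le> shifted_part \<kappa> i" if "i < i'" "i' < N" for i'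
      using shifted_part_less[OF \<kappa> that] by (simp add: d_def)
    ultimately show "h ` {..<\<kappa> ! i} \<union> d ` {i<..<N} \<subseteq> {1..shifted_part \<kappa> i}" by auto
    show "card (h ` {..<\<kappa> ! i} \<union> d ` {i<..<N}) = card {1..shifted_part \<kappa> i}"
      using disj inj_h inj_d i len by (simp add: card_Un_disjoint card_image shifted_part_def)
  qed auto
  then have "fact (shifted_part \<kappa> i) = \<Prod>(h ` {..<\<kappa> ! i} \<union> d ` {i<..<N})"
    by (simp add: fact_prod)
  also have "\<dots> = (\<Prod>j<\<kappa> ! i. h j) * (\<Prod>i'\<in>{i<..<N}. d i')"
    using disj inj_h inj_d by (simp add: prod.union_disjoint prod.reindex)
  finally show ?thesis by (simp add: h_def d_def)
qed

theorem hook_prod_formula: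
  assumes \<kappa>: "\<kappa> \<in> partitions N"
  shows "hook_prod \<kappa> * (\<Prod>i<N. \<Prod>i'\<in>{i<..<N}. shifted_part \<kappa> i - shifted_part \<kappa> i') =
    (\<Prod>i<N. fact (shifted_part \<kappa> i))"
proof -
  have "hook_prod \<kappa> = (\<Prod>i<N. \<Prod>j<\<kappa> ! i. arm \<kappa> (i, j) + leg \<kappa> (i, j) + 1)"
    using \<kappa> unfolding hook_prod_def diagram_eq_Sigma
    by (subst prod.Sigma) (auto simp: partitions_def)
  then show ?thesis
    using hook_row_prod[OF \<kappa>] by (simp flip: prod.distrib)
qed

text \<open>The shifted parts decrease, which costs one sign per pair of indices. The total sign
  depends on \<open>N\<close> alone and can be absorbed in a constant.\<close>

lemma vdm_shifted_part:
  assumes \<kappa>: "\<kappa> \<in> partitions N"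
  shows "vdm N (\<lambda>i. of_nat (shifted_part \<kappa> i)) = (\<Prod>j<N. \<Prod>i<j. -1) *
    (of_nat (\<Prod>i<N. \<Prod>i'\<in>{i<..<N}. shifted_part \<kappa> i - shifted_part \<kappa> i') :: 'a :: comm_ring_1)"
proof -
  let ?l = "shifted_part \<kappa>"
  have "vdm N (\<lambda>i. of_nat (?l i) :: 'a) = (\<Prod>j<N. \<Prod>i<j. (-1) * of_nat (?l i - ?l j))"
    unfolding vdm_def
    using shifted_part_less[OF \<kappa>] by (intro prod.cong) (auto simp: of_nat_diff less_imp_le)
  also have "\<dots> = (\<Prod>j<N. \<Prod>i<j. -1) * (\<Prod>j<N. \<Prod>i<j. of_nat (?l i - ?l j))"
    by (simp only: prod.distrib)
  also have "(\<Prod>j<N. \<Prod>i<j. of_nat (?l i - ?l j)) = (\<Prod>i<N. \<Prod>j\<in>{i<..<N}. of_nat (?l i - ?l j) :: 'a)"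
    by (subst (1 2) prod.Sigma)
      (auto intro!: prod.reindex_bij_witness[of _ "\<lambda>(i, j). (j, i)" "\<lambda>(i, j). (j, i)"])
  finally show ?thesis by simp
qed

lemma hook_prod_pos: "hook_prod \<kappa> > 0"
  unfolding hook_prod_def by (intro prod_pos) auto

section \<open>Semistandard tableaux\<close>

lemma finite_initial_segment:
  fixes A :: "nat set"
  assumes "finite A" "\<And>i j. j \<in> A \<Longrightarrow> i < j \<Longrightarrow> i \<in> A"
  shows "A = {..<card A}"
proof (cases "A = {}")
  case False
  have "A = {..Max A}"
  proof (intro equalityI subsetI)
    fix i assume "i \<in> {..Max A}"
    then show "i \<in> A"
      using assms(2)[of "Max A" i] Max_in[OF assms(1) False] by (cases "i = Max A") auto
  qed (use assms(1) in auto)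
  then show ?thesis by (metis card_atMost lessThan_Suc_atMost)
qed simp

lemma finite_ssyt [simp]: "finite (ssyt \<kappa> n)"
  by (rule finite_subset[of _ "diagram \<kappa> \<rightarrow>\<^sub>E {..<n}"]) (auto simp: ssyt_def intro!: finite_PiE)

lemma ssyt_less: "T \<in> ssyt \<kappa> n \<Longrightarrow> c \<in> diagram \<kappa> \<Longrightarrow> T c < n"
  using PiE_mem[of T "diagram \<kappa>" "\<lambda>_. {..<n}" c] by (simp add: ssyt_def)

lemma schur_replicate:
  "schur \<kappa> (replicate N x) = of_nat (card (ssyt \<kappa> N)) * x ^ sum_list \<kappa>"
proof -
  have "(\<Prod>c\<in>diagram \<kappa>. replicate N x ! T c) = x ^ sum_list \<kappa>" if "T \<in> ssyt \<kappa> N" for T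
  proof -
    have "(\<Prod>c\<in>diagram \<kappa>. replicate N x ! T c) = (\<Prod>c\<in>diagram \<kappa>. x)"
      using ssyt_less[OF that] by (intro prod.cong) auto
    then show ?thesis by (simp add: card_diagram)
  qed
  then show ?thesis by (simp add: schur_def)
qed

text \<open>The shapes that remain when a horizontal strip, the cells holding the largest entry, is
  removed, as in the branching rule for Schur functions.\<close>

definition interlacing :: "nat \<Rightarrow> nat list \<Rightarrow> nat list set" where
  "interlacing n \<kappa> = {\<rho>. length \<rho> = n \<and> (\<forall>i<n. \<kappa> ! Suc i \<le> \<rho> ! i \<and> \<rho> ! i \<le> \<kappa> ! i)}"

lemma interlacing_partitions: "interlacing n \<kappa> \<subseteq> partitions n"
proof
  fix \<rho> assume \<rho>: "\<rho> \<in> interlacing n \<kappa>"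
  have "\<rho> ! Suc i \<le> \<rho> ! i" if "Suc i < n" for i
    using \<rho> that order.trans[of "\<rho> ! Suc i" "\<kappa> ! Suc i" "\<rho> ! i"] by (simp add: interlacing_def)
  then have "sorted_wrt (\<ge>) \<rho>"
    using \<rho> by (subst sorted_wrt_iff_nth_Suc_transp) (auto simp: interlacing_def transp_def)
  then show "\<rho> \<in> partitions n" using \<rho> by (simp add: interlacing_def partitions_def)
qed

text \<open>The staircases for \<open>n + 1\<close> and \<open>n\<close> rows differ by one in each
  row, which makes the upper inequality strict. The interlacing shapes thus become a box of
  half-open intervals, over which sums factor row by row.\<close>

lemma bij_betw_interlacing:
  assumes \<kappa>: "\<kappa> \<in> partitions (Suc n)"
  shows "bij_betw (\<lambda>\<rho>. restrict (shifted_part \<rho>) {..<n}) (interlacing n \<kappa>)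
     (\<Pi>\<^sub>E i\<in>{..<n}. {shifted_part \<kappa> (Suc i)..<shifted_part \<kappa> i})"
proof (rule bij_betw_byWitness[where f' = "\<lambda>m. map (\<lambda>i. m i - (n - 1 - i)) [0..<n]"], goal_cases)
  case 1
  show ?case
    by (auto simp: interlacing_def shifted_part_def intro!: nth_equalityI)
next
  case 2
  show ?case
  proof
    fix m assume m: "m \<in> (\<Pi>\<^sub>E i\<in>{..<n}. {shifted_part \<kappa> (Suc i)..<shifted_part \<kappa> i})"
    have ge: "n - 1 - i \<le> m i" if "i < n" for i
    proof -
      have "shifted_part \<kappa> (Suc i) \<le> m i" using PiE_mem[OF m, of i] that by simp
      then show ?thesis using \<kappa> by (simp add: shifted_part_def partitions_def)
    qed
    show "restrict (shifted_part (map (\<lambda>i. m i - (n - 1 - i)) [0..<n])) {..<n} = m"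
    proof (intro ext, goal_cases)
      case (1 i)
      then show ?case
        using PiE_arb[OF m, of i] ge[of i] by (cases "i < n") (auto simp: shifted_part_def)
    qed
  qed
next
  case 3
  show ?case
  proof (intro image_subsetI restrict_PiE_iff[THEN iffD2] ballI)
    fix \<rho> i assume *: "\<rho> \<in> interlacing n \<kappa>" "i \<in> {..<n}"
    then have "\<kappa> ! Suc i \<le> \<rho> ! i" "\<rho> ! i \<le> \<kappa> ! i" "length \<rho> = n" by (auto simp: interlacing_def)
    then show "shifted_part \<rho> i \<in> {shifted_part \<kappa> (Suc i)..<shifted_part \<kappa> i}"
      using * \<kappa> by (simp add: shifted_part_def partitions_def) linarith
  qed
next
  case 4
  show ?case
  proof
    fix \<rho> assume "\<rho> \<in> (\<lambda>m. map (\<lambda>i. m i - (n - 1 - i)) [0..<n]) `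
      (\<Pi>\<^sub>E i\<in>{..<n}. {shifted_part \<kappa> (Suc i)..<shifted_part \<kappa> i})"
    then obtain m where m: "m \<in> (\<Pi>\<^sub>E i\<in>{..<n}. {shifted_part \<kappa> (Suc i)..<shifted_part \<kappa> i})"
      and \<rho>: "\<rho> = map (\<lambda>i. m i - (n - 1 - i)) [0..<n]" by auto
    have "\<kappa> ! Suc i \<le> m i - (n - 1 - i) \<and> m i - (n - 1 - i) \<le> \<kappa> ! i" if "i < n" for i
    proof -
      have "shifted_part \<kappa> (Suc i) \<le> m i" "m i < shifted_part \<kappa> i" using PiE_mem[OF m, of i] that by simp_all
      then show ?thesis using that \<kappa> by (simp add: shifted_part_def partitions_def) linarith
    qed
    then show "\<rho> \<in> interlacing n \<kappa>" by (simp add: \<rho> interlacing_def)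
  qed
qed

lemma finite_interlacing: "\<kappa> \<in> partitions (Suc n) \<Longrightarrow> finite (interlacing n \<kappa>)"
  using bij_betw_finite[OF bij_betw_interlacing] by (simp add: finite_PiE)

text \<open>Entries strictly increase down a column from at least 0. Cells with entry less than
  \<open>n\<close> therefore lie in the first \<open>n\<close> rows, so they fit into a shape of
  length \<open>n\<close>.\<close>

lemma ssyt_ge_row:
  assumes T: "T \<in> ssyt \<kappa> n" and \<kappa>: "\<kappa> \<in> partitions N" and "(i, j) \<in> diagram \<kappa>"
  shows "i \<le> T (i, j)"
  using assms(3)
proof (induction i)
  case (Suc i)
  have *: "(i, j) \<in> diagram \<kappa>"
    using Suc.prems partitions_nth_mono[OF \<kappa>, of i "Suc i"] \<kappa> by (auto simp: diagram_def partitions_def)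
  have "T (i, j) < T (Suc i, j)" using T * Suc.prems by (auto simp: ssyt_def)
  then show ?case using Suc.IH[OF *] by simp
qed simp

text \<open>The cells with entry less than \<open>n\<close> of a tableau with entries at most \<open>n\<close> form a tableau whose shape
  interlaces with the original one.\<close>

lemma bij_betw_ssyt_Suc:
  assumes \<kappa>: "\<kappa> \<in> partitions (Suc n)"
  shows "bij_betw (\<lambda>(\<rho>, S). \<lambda>c\<in>diagram \<kappa>. if c \<in> diagram \<rho> then S c else n)
     (SIGMA \<rho>:interlacing n \<kappa>. ssyt \<rho> n) (ssyt \<kappa> (Suc n))"
    (is "bij_betw ?f ?A ?B")
proof -
  have len: "length \<kappa> = Suc n" using \<kappa> by (simp add: partitions_def)
  have sub: "diagram \<rho> \<subseteq> diagram \<kappa>" if "\<rho> \<in> interlacing n \<kappa>" for \<rho>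
    using that len by (force simp: interlacing_def diagram_def)
  \<comment> \<open>The smaller shape can be read off from the extended tableau; this is what makes
    the map injective.\<close>
  have below: "{c \<in> diagram \<kappa>. ?f (\<rho>, S) c < n} = diagram \<rho>" if "(\<rho>, S) \<in> ?A" for \<rho> S
    using that sub[of \<rho>] ssyt_less[of S \<rho> n] by auto
  have inj: "inj_on ?f ?A"
  proof (rule inj_onI)
    fix x y assume x: "x \<in> ?A" and y: "y \<in> ?A" and eq: "?f x = ?f y"
    obtain \<rho> S \<rho>' S' where xy: "x = (\<rho>, S)" "y = (\<rho>', S')" by (cases x, cases y)
    have "diagram \<rho> = {c \<in> diagram \<kappa>. ?f (\<rho>, S) c < n}"
      by (rule below[symmetric]) (use x xy in simp)
    also have "\<dots> = {c \<in> diagram \<kappa>. ?f (\<rho>', S') c < n}" using eq xy by (simp only:)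
    also have "\<dots> = diagram \<rho>'" by (rule below) (use y xy in simp)
    finally have D: "diagram \<rho> = diagram \<rho>'" .
    have row: "{j. (i, j) \<in> diagram \<rho>} = {..<\<rho> ! i}" if "length \<rho> = n" "i < n" for \<rho> i
      using that by (auto simp: diagram_def)
    have lens: "length \<rho> = n" "length \<rho>' = n" using x y xy by (auto simp: interlacing_def)
    have "\<rho> = \<rho>'"
    proof (rule nth_equalityI)
      fix i assume "i < length \<rho>"
      then have "{..<\<rho> ! i} = {..<\<rho>' ! i}" using row[of \<rho> i] row[of \<rho>' i] lens D by simp
      then show "\<rho> ! i = \<rho>' ! i" by simp
    qed (simp add: lens)
    moreover have "S = S'"
    proof (rule extensionalityI[of _ "diagram \<rho>"])
      show "S \<in> extensional (diagram \<rho>)" "S' \<in> extensional (diagram \<rho>)"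
        using x y xy D by (auto simp: ssyt_def PiE_def)
      fix c assume c: "c \<in> diagram \<rho>"
      then have "c \<in> diagram \<kappa>" using sub[of \<rho>] x xy by auto
      then show "S c = S' c" using fun_cong[OF eq, of c] c D by (simp add: xy)
    qed
    ultimately show "x = y" by (simp add: xy)
  qed
  have into: "?f x \<in> ?B" if "x \<in> ?A" for x
  proof -
    obtain \<rho> S where x: "x = (\<rho>, S)" by (cases x)
    have \<rho>: "\<rho> \<in> interlacing n \<kappa>" and S: "S \<in> ssyt \<rho> n" using that x by auto
    have S_less: "S c < n" if "c \<in> diagram \<rho>" for c
      using ssyt_less[OF S that] .
    show ?thesis unfolding x prod.case ssyt_def
    proof (intro CollectI conjI allI impI, goal_cases)
      case 1
      show ?case using S_less[THEN less_SucI] by auto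
    next
      case (2 i j j')
      then have *: "(i, j) \<in> diagram \<rho>" if "(i, j') \<in> diagram \<rho>"
        using that by (auto simp: diagram_def)
      then show ?case
        using 2 S S_less by (auto simp: ssyt_def intro: less_imp_le)
    next
      case (3 i i' j)
      \<comment> \<open>The upper of two cells in a column lies in the smaller shape, because
        \<open>\<kappa> ! Suc i \<le> \<rho> ! i\<close>. Hence the filler \<open>n\<close> never
        occurs twice in a column.\<close>
      have *: "(i, j) \<in> diagram \<rho>"
      proof -
        have "i' \<le> n" "j < \<kappa> ! i'" using 3 len by (auto simp: diagram_def)
        then have "i < n" "j < \<kappa> ! Suc i"
          using 3 partitions_nth_mono[OF \<kappa>, of "Suc i" i'] by auto
        then show ?thesis using \<rho> by (force simp: interlacing_def diagram_def)
      qed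
      then show ?case using 3 S S_less[OF *] by (auto simp: ssyt_def)
    qed
  qed
  have onto: "T \<in> ?f ` ?A" if T: "T \<in> ?B" for T
  proof -
    have row: "T (i, j) \<le> T (i, j')" if "j < j'" "(i, j) \<in> diagram \<kappa>" "(i, j') \<in> diagram \<kappa>" for i j j'
      using T that unfolding ssyt_def by blast
    have col: "T (i, j) < T (i', j)" if "i < i'" "(i, j) \<in> diagram \<kappa>" "(i', j) \<in> diagram \<kappa>" for i i' j
      using T that unfolding ssyt_def by blast
    have T_le: "T c \<le> n" if "c \<in> diagram \<kappa>" for c using ssyt_less[OF T that] by simp
    \<comment> \<open>Rows increase weakly, so the cells with entry less than \<open>n\<close> form
      an initial segment of each row, and its length is the new part.\<close>
    define R where "R i = {j. j < \<kappa> ! i \<and> T (i, j) < n}" for i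
    define \<rho> where "\<rho> = map (\<lambda>i. card (R i)) [0..<n]"
    have R: "R i = {..<card (R i)}" if "i \<le> n" for i
    proof -
      have "finite (R i)" by (rule finite_subset[of _ "{..<\<kappa> ! i}"]) (auto simp: R_def)
      moreover have "j \<in> R i" if "j' \<in> R i" "j < j'" for j j'
        using that \<open>i \<le> n\<close> row[of j j' i] len by (auto simp: R_def diagram_def)
      ultimately show ?thesis
        by (intro finite_initial_segment)
    qed
    have D: "diagram \<rho> = {c \<in> diagram \<kappa>. T c < n}"
    proof (intro equalityI subsetI)
      fix c assume "c \<in> diagram \<rho>"
      then obtain i j where c: "c = (i, j)" "i < n" "j < card (R i)"
        by (auto simp: diagram_def \<rho>_def)
      then have "j \<in> R i" using R[of i] by auto
      with c show "c \<in> {c \<in> diagram \<kappa>. T c < n}" using len by (auto simp: R_def diagram_def)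
    next
      fix c assume *: "c \<in> {c \<in> diagram \<kappa>. T c < n}"
      obtain i j where c: "c = (i, j)" by (cases c)
      have "i < n" using ssyt_ge_row[OF T \<kappa>, of i j] * c by simp
      moreover have "j \<in> R i" using * c by (auto simp: R_def diagram_def)
      ultimately show "c \<in> diagram \<rho>"
        using R[of i] by (auto simp: c diagram_def \<rho>_def)
    qed
    have \<rho>: "\<rho> \<in> interlacing n \<kappa>"
    proof -
      have "\<kappa> ! Suc i \<le> card (R i)" if "i < n" for i
      proof -
        have "{..<\<kappa> ! Suc i} \<subseteq> R i"
        proof
          fix j assume "j \<in> {..<\<kappa> ! Suc i}"
          then have "(i, j) \<in> diagram \<kappa>" "(Suc i, j) \<in> diagram \<kappa>"
            using that len partitions_nth_mono[OF \<kappa>, of i "Suc i"] by (auto simp: diagram_def)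
          then have "T (i, j) < n" using col[of i "Suc i" j] T_le by (force dest: order.strict_trans2)
          with \<open>(i, j) \<in> diagram \<kappa>\<close> show "j \<in> R i" by (auto simp: R_def diagram_def)
        qed
        then have "{..<\<kappa> ! Suc i} \<subseteq> {..<card (R i)}" using R[of i] that by simp
        then show ?thesis by simp
      qed
      moreover have "card (R i) \<le> \<kappa> ! i" for i
        using card_mono[of "{..<\<kappa> ! i}" "R i"] by (auto simp: R_def)
      ultimately show ?thesis by (simp add: interlacing_def \<rho>_def)
    qed
    have "restrict T (diagram \<rho>) \<in> ssyt \<rho> n"
      using row col D by (auto simp: ssyt_def)
    moreover have "T = ?f (\<rho>, restrict T (diagram \<rho>))"
    proof (rule extensionalityI[of _ "diagram \<kappa>"])
      show "T \<in> extensional (diagram \<kappa>)" using T by (auto simp: ssyt_def PiE_def)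
      fix c assume "c \<in> diagram \<kappa>"
      then show "T c = ?f (\<rho>, restrict T (diagram \<rho>)) c"
        using D T_le[of c] by (auto simp: le_less)
    qed auto
    ultimately show ?thesis using \<rho> by blast
  qed
  show ?thesis
    unfolding bij_betw_def using inj into onto by blast
qed

lemma card_ssyt_Suc:
  assumes \<kappa>: "\<kappa> \<in> partitions (Suc n)"
  shows "card (ssyt \<kappa> (Suc n)) = (\<Sum>\<rho>\<in>interlacing n \<kappa>. card (ssyt \<rho> n))"
  using bij_betw_same_card[OF bij_betw_ssyt_Suc[OF \<kappa>]] finite_interlacing[OF \<kappa>]
  by (simp add: card_SigmaI)

section \<open>The number of tableaux as a determinant of binomial coefficients\<close>

lemma det_mat_rows:
  fixes f :: "nat \<Rightarrow> nat \<Rightarrow> 'a :: comm_ring_1"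
  shows "Determinant.det (Matrix.mat n n (\<lambda>(i, j). f i j)) =
    (\<Sum>p | p permutes {0..<n}. of_int (sign p) * (\<Prod>i<n. f i (p i)))"
  by (subst det_mat_transpose[symmetric]) (rule det_mat_cols)

lemma det_mat_sum_rows:
  fixes f :: "'b \<Rightarrow> nat \<Rightarrow> 'a :: comm_ring_1"
  assumes "\<And>i. i < n \<Longrightarrow> finite (S i)"
  shows "Determinant.det (Matrix.mat n n (\<lambda>(i, k). \<Sum>m\<in>S i. f m k)) =
    (\<Sum>l\<in>(\<Pi>\<^sub>E i\<in>{..<n}. S i). Determinant.det (Matrix.mat n n (\<lambda>(i, k). f (l i) k)))"
proof -
  have "(\<Prod>i<n. \<Sum>m\<in>S i. f m (p i)) = (\<Sum>l\<in>(\<Pi>\<^sub>E i\<in>{..<n}. S i). \<Prod>i<n. f (l i) (p i))" for p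
    using assms by (intro prod_sum_PiE) auto
  then show ?thesis
    unfolding det_mat_rows by (simp add: sum_distrib_left) (rule sum.swap)
qed

text \<open>By Pascal's rule the sum telescopes.\<close>

lemma sum_binomial_diff:
  assumes "a \<le> b"
  shows "(\<Sum>m\<in>{a..<b}. of_nat (m choose r)) = (of_nat (b choose Suc r) - of_nat (a choose Suc r) :: 'a :: comm_ring_1)"
  using sum_Suc_diff'[OF assms, of "\<lambda>m. of_nat (m choose Suc r) :: 'a"] by simp

text \<open>Subtract from every row the next one and expand along the last column.\<close>

lemma det_binomial_Suc:
  fixes l :: "nat \<Rightarrow> nat"
  assumes l: "\<And>i. i < n \<Longrightarrow> l (Suc i) \<le> l i"
  shows "Determinant.det (Matrix.mat (Suc n) (Suc n) (\<lambda>(i, k). of_nat (l i choose (n - k)))) =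
    (\<Sum>m\<in>(\<Pi>\<^sub>E i\<in>{..<n}. {l (Suc i)..<l i}).
      Determinant.det (Matrix.mat n n (\<lambda>(i, k). of_nat (m i choose (n - 1 - k)))) :: 'a :: comm_ring_1)"
proof -
  let ?M = "Matrix.mat (Suc n) (Suc n) (\<lambda>(i, k). of_nat (l i choose (n - k)) :: 'a)"
  define U where "U = Matrix.mat (Suc n) (Suc n) (\<lambda>(i, j). if j = i then 1 else if j = Suc i then -1 else 0 :: 'a)"
  have "Determinant.det U = prod_list (diag_mat U)"
    by (intro det_upper_triangular[of _ "Suc n"] upper_triangularI) (auto simp: U_def)
  also have "\<dots> = 1" by (auto simp: prod_list_diag_prod U_def intro!: prod.neutral)
  finally have "Determinant.det ?M = Determinant.det (U * ?M)"
    by (subst det_mult[of _ "Suc n"]) (auto simp: U_def)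
  also have "U * ?M = Matrix.mat (Suc n) (Suc n) (\<lambda>(i, k). of_nat (l i choose (n - k)) -
      (if i < n then of_nat (l (Suc i) choose (n - k)) else 0))" (is "_ = ?A")
  proof (intro eq_matI, goal_cases)
    case (1 i k)
    then have ik: "i < Suc n" "k < Suc n" by auto
    have "(U * ?M) $$ (i, k) = (\<Sum>j\<in>{0..<Suc n}. U $$ (i, j) * of_nat (l j choose (n - k)))"
      using ik by (simp add: U_def scalar_prod_def del: sum.op_ivl_Suc)
    also have "\<dots> = (\<Sum>j\<in>{0..<Suc n}. (if j = i then of_nat (l j choose (n - k)) else 0) -
        (if j = Suc i then of_nat (l j choose (n - k)) else 0))"
      using ik by (intro sum.cong) (auto simp: U_def)
    also have "\<dots> = ?A $$ (i, k)"
      using ik by (simp add: sum_subtractf sum.delta del: sum.op_ivl_Suc)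
    finally show ?case .
  qed (auto simp: U_def)
  also have "Determinant.det ?A = (\<Sum>i<Suc n. ?A $$ (i, n) * cofactor ?A i n)"
    by (rule laplace_expansion_column) auto
  \<comment> \<open>The last column consists of binomials with lower index 0, all equal to 1, so the
    row differences vanish there except in the last row.\<close>
  also have "\<dots> = cofactor ?A n n"
    by simp
  also have "\<dots> = Determinant.det (mat_delete ?A n n)"
    by (simp add: cofactor_def flip: mult_2)
  also have "mat_delete ?A n n = Matrix.mat n n (\<lambda>(i, k). \<Sum>m\<in>{l (Suc i)..<l i}. of_nat (m choose (n - 1 - k)))"
  proof (intro eq_matI, goal_cases)
    case (1 i k)
    then have "n - k = Suc (n - 1 - k)" by simp
    with 1 show ?case using l[of i] by (simp add: mat_delete_def sum_binomial_diff)
  qed (auto simp: mat_delete_def)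
  also have "Determinant.det \<dots> = (\<Sum>m\<in>(\<Pi>\<^sub>E i\<in>{..<n}. {l (Suc i)..<l i}).
      Determinant.det (Matrix.mat n n (\<lambda>(i, k). of_nat (m i choose (n - 1 - k)))))"
    by (rule det_mat_sum_rows) auto
  finally show ?thesis .
qed

text \<open>Both sides obey the same recursion. Removing the largest entry sums the count over
  interlacing shapes, which in shifted coordinates is the box over which the binomial determinant of
  size \<open>n + 1\<close> decomposes.\<close>

theorem card_ssyt_det:
  assumes "\<kappa> \<in> partitions N"
  shows "of_nat (card (ssyt \<kappa> N)) =
    (Determinant.det (Matrix.mat N N (\<lambda>(i, k). of_nat (shifted_part \<kappa> i choose (N - 1 - k)))) :: 'a :: comm_ring_1)"
  using assms
proof (induction N arbitrary: \<kappa>)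
  case 0
  then have "diagram \<kappa> = {}" by (simp add: partitions_def diagram_def)
  then have "ssyt \<kappa> 0 = {\<lambda>_. undefined}" by (simp add: ssyt_def)
  then show ?case by simp
next
  case (Suc n)
  let ?D = "\<lambda>l. Determinant.det (Matrix.mat n n (\<lambda>(i, k). of_nat (l i choose (n - 1 - k)) :: 'a))"
  have "of_nat (card (ssyt \<kappa> (Suc n))) = (\<Sum>\<rho>\<in>interlacing n \<kappa>. of_nat (card (ssyt \<rho> n)) :: 'a)"
    by (simp add: card_ssyt_Suc[OF Suc.prems])
  also have "\<dots> = (\<Sum>\<rho>\<in>interlacing n \<kappa>. ?D (restrict (shifted_part \<rho>) {..<n}))"
  proof (intro sum.cong refl)
    fix \<rho> assume "\<rho> \<in> interlacing n \<kappa>"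
    then have "of_nat (card (ssyt \<rho> n)) = ?D (shifted_part \<rho>)"
      using Suc.IH interlacing_partitions by blast
    also have "\<dots> = ?D (restrict (shifted_part \<rho>) {..<n})"
      by (intro arg_cong[where f = Determinant.det] eq_matI) auto
    finally show "of_nat (card (ssyt \<rho> n)) = ?D (restrict (shifted_part \<rho>) {..<n})" .
  qed
  also have "\<dots> = (\<Sum>m\<in>(\<Pi>\<^sub>E i\<in>{..<n}. {shifted_part \<kappa> (Suc i)..<shifted_part \<kappa> i}). ?D m)"
    by (rule sum.reindex_bij_betw[OF bij_betw_interlacing[OF Suc.prems]])
  also have "\<dots> = Determinant.det (Matrix.mat (Suc n) (Suc n) (\<lambda>(i, k). of_nat (shifted_part \<kappa> i choose (n - k))))"
    using shifted_part_less[OF Suc.prems] by (intro det_binomial_Suc[symmetric]) (auto intro: less_imp_le)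
  finally show ?case by simp
qed

text \<open>Weyl's dimension formula, up to the normalising constant.\<close>

theorem card_ssyt_vdm:
  obtains c :: complex where "c \<noteq> 0"
    "\<And>\<kappa>. \<kappa> \<in> partitions N \<Longrightarrow> of_nat (card (ssyt \<kappa> N)) = c * vdm N (\<lambda>i. of_nat (shifted_part \<kappa> i))"
proof -
  \<comment> \<open>Reversal of the columns, to put the lower indices of the binomials in increasing
    order; its sign becomes part of \<open>c\<close>.\<close>
  define p where "p k = (if k < N then N - 1 - k else k)" for k
  have p: "p permutes {0..<N}"
    by (rule inj_on_nat_permutes) (auto simp: p_def inj_on_def)
  define c :: complex where "c = of_int (sign p) * (\<Prod>k<N. 1 / fact k)"
  have "of_nat (card (ssyt \<kappa> N)) = c * vdm N (\<lambda>i. of_nat (shifted_part \<kappa> i))"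
    if \<kappa>: "\<kappa> \<in> partitions N" for \<kappa>
  proof -
    let ?l = "shifted_part \<kappa>"
    have "of_nat (card (ssyt \<kappa> N)) =
        Determinant.det (Matrix.mat N N (\<lambda>(i, k). of_nat (?l i choose p k) :: complex))"
      unfolding card_ssyt_det[OF \<kappa>]
      by (intro arg_cong[where f = Determinant.det] eq_matI) (auto simp: p_def)
    also have "\<dots> = of_int (sign p) * Determinant.det (Matrix.mat N N (\<lambda>(i, k). of_nat (?l i choose k)))"
      by (rule det_mat_permute_cols[OF p, of "\<lambda>i k. of_nat (?l i choose k)"])
    also have "Determinant.det (Matrix.mat N N (\<lambda>(i, k). of_nat (?l i choose k))) =
        Determinant.det (Matrix.mat N N (\<lambda>(i, k). 1 / fact k * (\<Prod>m<k. of_nat (?l i) - of_nat m :: complex)))"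
      by (intro arg_cong[where f = Determinant.det] eq_matI)
        (auto simp: binomial_gbinomial gbinomial_prod_rev atLeast0LessThan)
    also have "\<dots> = (\<Prod>k<N. 1 / fact k) * Determinant.det (Matrix.mat N N (\<lambda>(i, k). \<Prod>m<k. of_nat (?l i) - of_nat m))"
      by (rule det_mat_scale_cols)
    also have "Determinant.det (Matrix.mat N N (\<lambda>(i, k). \<Prod>m<k. of_nat (?l i) - of_nat m)) =
        vdm N (\<lambda>i. of_nat (?l i) :: complex)"
      using det_falling[of N "\<lambda>i. of_nat (?l i) :: complex"]
      by (subst det_mat_transpose[symmetric])
    finally show ?thesis by (simp add: c_def)
  qed
  moreover have "c \<noteq> 0" by (simp add: c_def sign_def)
  ultimately show ?thesis using that by blast
qed

section \<open>Fourier coefficients of the weight\<close>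

text \<open>On the unit circle \<open>\<bar>1 + z\<bar> = 2 * cos (\<theta> / 2)\<close>, so this is \<open>\<bar>1 + z\<bar> powr s * exp (\<i> b \<theta>)\<close>, extended by
  \<open>0\<close> so that all integrals can be taken over the real line.\<close>

definition circle_kernel :: "complex \<Rightarrow> complex \<Rightarrow> real \<Rightarrow> complex" where
  "circle_kernel s b \<theta> =
     (if -pi < \<theta> \<and> \<theta> < pi then exp (of_real \<theta> * (\<i> * b) + s * of_real (ln (2 * cos (\<theta> / 2)))) else 0)"

lemma circle_kernel_measurable [measurable]: "circle_kernel s b \<in> borel_measurable borel"
proof -
  have [measurable]: "(exp :: complex \<Rightarrow> complex) \<in> borel_measurable borel"
    by (intro borel_measurable_continuous_onI continuous_intros)
  show ?thesis unfolding circle_kernel_def by measurable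
qed

text \<open>The cubic Taylor bound gives x - x^3/6, and x^2 \<le> 4 on this range. It yields a
  linear lower bound for the cosine near the singular points -pi and pi.\<close>

lemma sin_ge_third:
  fixes x :: real
  assumes "0 \<le> x" "x \<le> 2"
  shows "x / 3 \<le> sin x"
proof -
  have "\<bar>sin x - (\<Sum>m<3. sin_coeff m * x ^ m)\<bar> \<le> inverse (fact 3) * \<bar>x\<bar> ^ 3"
    by (rule Maclaurin_sin_bound)
  then have "x - sin x \<le> x * x\<^sup>2 / 6"
    using assms by (simp add: eval_nat_numeral sin_coeff_def abs_if fact_reduce split: if_splits)
  moreover have "x * x\<^sup>2 \<le> x * 2\<^sup>2"
    using assms by (intro mult_left_mono power_mono) auto
  ultimately show ?thesis by simp
qed

lemma cos_half_ge:
  assumes "\<bar>\<theta>\<bar> \<le> pi"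
  shows "(pi - \<bar>\<theta>\<bar>) / 3 \<le> 2 * cos (\<theta> / 2)"
proof -
  have "(pi - \<bar>\<theta>\<bar>) / 2 \<le> 2" using pi_half_less_two by simp
  then have "(pi - \<bar>\<theta>\<bar>) / 2 / 3 \<le> sin ((pi - \<bar>\<theta>\<bar>) / 2)"
    using assms by (intro sin_ge_third) auto
  also have "sin ((pi - \<bar>\<theta>\<bar>) / 2) = cos (\<theta> / 2)"
    by (simp add: diff_divide_distrib sin_diff abs_if)
  finally show ?thesis by simp
qed

lemma cos_half_pos: "-pi < \<theta> \<Longrightarrow> \<theta> < pi \<Longrightarrow> cos (\<theta> / 2) > 0"
  by (intro cos_gt_zero_pi) auto

lemma integrable_powr_endpoint:
  fixes a c :: real
  assumes "a > -1" "c \<ge> 0"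
  shows "integrable lborel (\<lambda>x. indicator {0..c} x * x powr a)"
proof -
  have "(\<lambda>x. x powr a) absolutely_integrable_on {0..c}"
    using has_integral_powr_from_0[OF assms]
    by (intro nonnegative_absolutely_integrable_1) auto
  then have "integrable (completion lborel) (\<lambda>x. indicator {0..c} x * x powr a)"
    by (simp add: set_integrable_def)
  then show ?thesis
    by (subst (asm) integrable_completion) auto
qed

lemma norm_circle_kernel:
  "-pi < \<theta> \<Longrightarrow> \<theta> < pi \<Longrightarrow>
    norm (circle_kernel s b \<theta>) = exp (- \<theta> * Im b) * (2 * cos (\<theta> / 2)) powr Re s"
  using cos_half_pos[of \<theta>] by (simp add: circle_kernel_def exp_add norm_mult powr_def)

lemma integrable_circle_kernel:
  assumes "Re s > -1"
  shows "integrable lborel (circle_kernel s b)"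
proof -
  \<comment> \<open>The exponent is split: the nonnegative part \<open>Re s - \<sigma>\<close> is
    controlled by the upper bound 2 for the cosine factor, the nonpositive part \<sigma> by its
    linear lower bound, and \<open>\<sigma> > -1\<close> keeps the majorant integrable.\<close>
  define \<sigma> where "\<sigma> = min (Re s) 0"
  define f where "f x = indicator {0..2 * pi} x * x powr \<sigma>" for x :: real
  define M where "M = exp (pi * \<bar>Im b\<bar>) * 2 powr (Re s - \<sigma>) * (1 / 3) powr \<sigma>"
  have f: "integrable lborel f"
    unfolding f_def using assms by (intro integrable_powr_endpoint) (auto simp: \<sigma>_def)
  have "integrable lborel (\<lambda>\<theta>. f (pi + (-1) * \<theta>))" "integrable lborel (\<lambda>\<theta>. f (pi + 1 * \<theta>))"
    by (rule lborel_integrable_real_affine[OF f], simp)+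
  then have "integrable lborel (\<lambda>\<theta>. M * (f (pi - \<theta>) + f (pi + \<theta>)))" by simp
  then show ?thesis
  proof (rule Bochner_Integration.integrable_bound)
    have "norm (circle_kernel s b \<theta>) \<le> norm (M * (f (pi - \<theta>) + f (pi + \<theta>)))" for \<theta>
    proof (cases "-pi < \<theta> \<and> \<theta> < pi")
      case True
      let ?u = "2 * cos (\<theta> / 2)"
      have u: "?u > 0" "?u \<le> 2" using cos_half_pos[of \<theta>] True by auto
      have "- \<theta> * Im b \<le> \<bar>\<theta> * Im b\<bar>" by simp
      also have "\<dots> \<le> pi * \<bar>Im b\<bar>" unfolding abs_mult using True by (intro mult_right_mono) auto
      finally have 1: "exp (- \<theta> * Im b) \<le> exp (pi * \<bar>Im b\<bar>)" by simp
      have "?u powr Re s = ?u powr (Re s - \<sigma>) * ?u powr \<sigma>" by (simp flip: powr_add)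
      also have "\<dots> \<le> 2 powr (Re s - \<sigma>) * ((pi - \<bar>\<theta>\<bar>) / 3) powr \<sigma>"
        using u cos_half_ge[of \<theta>] True
        by (intro mult_mono powr_mono2 powr_mono2') (auto simp: \<sigma>_def abs_if)
      also have "((pi - \<bar>\<theta>\<bar>) / 3) powr \<sigma> = (1 / 3) powr \<sigma> * (pi - \<bar>\<theta>\<bar>) powr \<sigma>"
        using True by (subst powr_mult[symmetric]) (auto simp: abs_if)
      also have "(pi - \<bar>\<theta>\<bar>) powr \<sigma> \<le> f (pi - \<theta>) + f (pi + \<theta>)"
        using True by (cases "\<theta> \<ge> 0") (auto simp: f_def)
      finally have 2: "?u powr Re s \<le> 2 powr (Re s - \<sigma>) * ((1 / 3) powr \<sigma> * (f (pi - \<theta>) + f (pi + \<theta>)))"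
        by (simp add: mult_left_mono)
      have "norm (circle_kernel s b \<theta>) = exp (- \<theta> * Im b) * ?u powr Re s"
        using True by (simp add: norm_circle_kernel)
      also have "\<dots> \<le> exp (pi * \<bar>Im b\<bar>) * (2 powr (Re s - \<sigma>) * ((1 / 3) powr \<sigma> * (f (pi - \<theta>) + f (pi + \<theta>))))"
        using 1 2 by (intro mult_mono) auto
      also have "\<dots> = M * (f (pi - \<theta>) + f (pi + \<theta>))" by (simp add: M_def mult_ac)
      finally show ?thesis by (simp add: abs_le_iff)
    qed (auto simp: circle_kernel_def)
    then show "AE \<theta> in lborel. norm (circle_kernel s b \<theta>) \<le> norm (M * (f (pi - \<theta>) + f (pi + \<theta>)))"
      by simp
  qed simp
qed

text \<open>Raising \<open>s\<close> by one supplies a factor 2 cos(\<theta>/2), which cancels the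
  denominator in the derivative of the logarithm. Cosine and sine split into exp(i\<theta>/2) and
  exp(-i\<theta>/2), and with the centre \<open>b - 1 / 2\<close> these land on the parameters
  \<open>b\<close> and \<open>b - 1\<close>.\<close>

lemma circle_kernel_has_vector_derivative:
  assumes "-pi < \<theta>" "\<theta> < pi"
  shows "(circle_kernel (s + 1) (b - 1 / 2) has_vector_derivative
     (\<i> * (b + s / 2) * circle_kernel s b \<theta> + \<i> * (b - 1 - s / 2) * circle_kernel s (b - 1) \<theta>)) (at \<theta>)"
proof -
  let ?u = "2 * cos (\<theta> / 2)"
  let ?e = "\<lambda>\<theta>. of_real \<theta> * (\<i> * (b - 1 / 2)) + (s + 1) * of_real (ln (2 * cos (\<theta> / 2)))"
  let ?e' = "\<i> * (b - 1 / 2) + (s + 1) * of_real (- sin (\<theta> / 2) / ?u)"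
  have u: "?u > 0" using cos_half_pos[OF assms] by simp
  have "((\<lambda>\<theta>. ln (2 * cos (\<theta> / 2))) has_real_derivative (- sin (\<theta> / 2) / ?u)) (at \<theta>)"
    using u by (auto intro!: derivative_eq_intros simp: field_simps)
  then have "((\<lambda>\<theta>. complex_of_real (ln (2 * cos (\<theta> / 2)))) has_vector_derivative of_real (- sin (\<theta> / 2) / ?u)) (at \<theta>)"
    by (rule has_vector_derivative_of_real)
  with u have e: "(?e has_vector_derivative ?e') (at \<theta>)"
    by (auto intro!: derivative_eq_intros)
  have "((exp \<circ> ?e) has_vector_derivative (?e' * exp (?e \<theta>))) (at \<theta>)"
    by (rule field_vector_diff_chain_at[OF e]) (rule DERIV_exp)
  then have "(circle_kernel (s + 1) (b - 1 / 2) has_vector_derivative (?e' * exp (?e \<theta>))) (at \<theta>)"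
    by (rule has_vector_derivative_transform_within_open[where S = "{-pi<..<pi}"])
      (use assms in \<open>auto simp: circle_kernel_def\<close>)
  also have "?e' * exp (?e \<theta>) =
     \<i> * (b + s / 2) * circle_kernel s b \<theta> + \<i> * (b - 1 - s / 2) * circle_kernel s (b - 1) \<theta>"
  proof -
    define E where "E = exp (of_real \<theta> * (\<i> * (b - 1 / 2)) + s * of_real (ln ?u))"
    define c where "c = exp (\<i> * of_real (\<theta> / 2))"
    define d where "d = exp (- (\<i> * of_real (\<theta> / 2)))"
    have "exp (complex_of_real (ln ?u)) = of_real ?u"
      using u by (simp only: exp_of_real exp_ln)
    moreover have "exp (?e \<theta>) = E * exp (complex_of_real (ln ?u))"
      by (simp add: E_def algebra_simps flip: exp_add)
    ultimately have eE: "exp (?e \<theta>) = E * of_real ?u" by (simp only:)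
    have cd: "complex_of_real ?u = c + d" "complex_of_real (sin (\<theta> / 2)) = (c - d) / (2 * \<i>)"
      unfolding c_def d_def by (simp_all add: cos_of_real[symmetric] sin_of_real[symmetric] cos_exp_eq sin_exp_eq)
    have k: "circle_kernel s b \<theta> = E * c" "circle_kernel s (b - 1) \<theta> = E * d"
      using assms by (simp_all add: circle_kernel_def E_def c_def d_def algebra_simps flip: exp_add)
    have "?e' * exp (?e \<theta>) = E * (\<i> * (b - 1 / 2) * of_real ?u - (s + 1) * of_real (sin (\<theta> / 2)))"
      unfolding eE using u by (simp add: field_simps)
    also have "\<dots> = \<i> * (b + s / 2) * circle_kernel s b \<theta> + \<i> * (b - 1 - s / 2) * circle_kernel s (b - 1) \<theta>"
      unfolding cd k by (simp add: field_simps)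
    finally show ?thesis .
  qed
  finally show ?thesis .
qed

lemma circle_kernel_eq_powr:
  assumes "-pi \<le> \<theta>" "\<theta> \<le> pi"
  shows "circle_kernel s b \<theta> = exp (of_real \<theta> * (\<i> * b)) * of_real (2 * cos (\<theta> / 2)) powr s"
proof (cases "-pi < \<theta> \<and> \<theta> < pi")
  case True
  then have "cos (\<theta> / 2) > 0" by (intro cos_half_pos) auto
  then have "Ln (complex_of_real (2 * cos (\<theta> / 2))) = of_real (ln (2 * cos (\<theta> / 2)))"
    by (intro Ln_of_real) simp
  with True \<open>cos (\<theta> / 2) > 0\<close> show ?thesis
    by (simp add: circle_kernel_def exp_add powr_def del: of_real_mult)
next
  case False
  then have "\<theta> = pi \<or> \<theta> = - pi" using assms by auto
  then show ?thesis by (auto simp: circle_kernel_def)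
qed

text \<open>At the end points the cosine vanishes, and the value 0 of the power agrees with the
  extension by 0; for \<open>Re s > 0\<close> it is also the limit.\<close>

lemma continuous_on_circle_kernel:
  assumes "Re s > 0"
  shows "continuous_on {-pi..pi} (circle_kernel s b)"
proof -
  have "cos (\<theta> / 2) \<ge> 0" if "\<theta> \<in> {-pi..pi}" for \<theta>
    using that by (intro cos_ge_zero) auto
  then have "continuous_on {-pi..pi} (\<lambda>\<theta>. exp (of_real \<theta> * (\<i> * b)) * of_real (2 * cos (\<theta> / 2)) powr s)"
    using assms by (intro continuous_intros) auto
  then show ?thesis
    by (rule continuous_on_cong[THEN iffD1, rotated 2]) (auto simp: circle_kernel_eq_powr)
qed

text \<open>The function differentiated is the kernel with parameters \<open>s + 1\<close> and \<open>b - 1 / 2\<close>, which vanishes at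
  both end points.\<close>

lemma integral_circle_kernel_step:
  assumes "Re s > -1"
  shows "(b + s / 2) * (\<integral>\<theta>. circle_kernel s b \<theta> \<partial>lborel) =
    (s / 2 + 1 - b) * (\<integral>\<theta>. circle_kernel s (b - 1) \<theta> \<partial>lborel)"
proof -
  let ?F' = "\<lambda>\<theta>. \<i> * (b + s / 2) * circle_kernel s b \<theta> + \<i> * (b - 1 - s / 2) * circle_kernel s (b - 1) \<theta>"
  have int: "integrable lborel (circle_kernel s b)" for b
    by (rule integrable_circle_kernel[OF assms])
  have "(?F' has_integral (circle_kernel (s + 1) (b - 1 / 2) pi - circle_kernel (s + 1) (b - 1 / 2) (-pi))) {-pi..pi}"
    using assms
    by (intro fundamental_theorem_of_calculus_interior circle_kernel_has_vector_derivative
        continuous_on_circle_kernel) auto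
  then have "(?F' has_integral 0) {-pi..pi}" by (simp add: circle_kernel_def)
  then have 0: "(?F' has_integral 0) UNIV"
    by (rule has_integral_on_superset) (auto simp: circle_kernel_def)
  have "(?F' has_integral (\<integral>\<theta>. ?F' \<theta> \<partial>lborel)) UNIV"
    using int[of b] int[of "b - 1"] by (intro has_integral_integral_lborel) auto
  with 0 have "(\<integral>\<theta>. ?F' \<theta> \<partial>lborel) = 0" by (rule has_integral_unique[symmetric])
  also have "(\<integral>\<theta>. ?F' \<theta> \<partial>lborel) = \<i> * ((b + s / 2) * (\<integral>\<theta>. circle_kernel s b \<theta> \<partial>lborel)
      + (b - 1 - s / 2) * (\<integral>\<theta>. circle_kernel s (b - 1) \<theta> \<partial>lborel))"
    using int[of b] int[of "b - 1"] by (simp add: ring_distribs mult.assoc)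
  finally have "(b + s / 2) * (\<integral>\<theta>. circle_kernel s b \<theta> \<partial>lborel)
      + (b - 1 - s / 2) * (\<integral>\<theta>. circle_kernel s (b - 1) \<theta> \<partial>lborel) = 0"
    by simp
  then show ?thesis by (simp add: algebra_simps eq_neg_iff_add_eq_0)
qed

text \<open>The Fourier coefficients of the weight at \<open>t = 0\<close>.\<close>

definition jacobi_coeff :: "complex \<Rightarrow> complex \<Rightarrow> int \<Rightarrow> complex" where
  "jacobi_coeff \<mu> \<nu> n =
     (\<integral>\<theta>. circle_kernel (\<mu> + \<nu>) ((\<mu> - \<nu>) / 2 - of_int n) \<theta> \<partial>lborel) / (2 * of_real pi)"

lemma jacobi_coeff_rec:
  assumes "Re (\<mu> + \<nu>) > -1"
  shows "(\<mu> - of_int n) * jacobi_coeff \<mu> \<nu> n = (\<nu> + of_int n + 1) * jacobi_coeff \<mu> \<nu> (n + 1)"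
proof -
  have *: "(\<mu> - \<nu>) / 2 - of_int n + (\<mu> + \<nu>) / 2 = \<mu> - of_int n"
    "(\<mu> + \<nu>) / 2 + 1 - ((\<mu> - \<nu>) / 2 - of_int n) = \<nu> + of_int n + 1"
    "(\<mu> - \<nu>) / 2 - of_int n - 1 = (\<mu> - \<nu>) / 2 - of_int (n + 1)"
    by (simp_all add: field_simps)
  show ?thesis
    using integral_circle_kernel_step[OF assms, of "(\<mu> - \<nu>) / 2 - of_int n"]
    unfolding * jacobi_coeff_def by simp
qed

lemma rGamma_nonzero_Re: "Re z > 0 \<Longrightarrow> rGamma z \<noteq> 0"
  by (auto simp: rGamma_eq_zero_iff elim!: nonpos_Ints_cases)

text \<open>The two-term recurrence determines the sequence up to a factor: its coefficients vanish at most at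
  \<open>n = \<mu>\<close> and \<open>n = - \<nu> - 1\<close>, and \<open>Re (- \<nu> - 1) < Re \<mu>\<close>, so one can start strictly between.\<close>

lemma jacobi_coeff_rGamma:
  assumes "Re (\<mu> + \<nu>) > -1"
  obtains C where
    "\<And>n. jacobi_coeff \<mu> \<nu> n = C * (rGamma (1 + \<mu> - of_int n) * rGamma (1 + \<nu> + of_int n))"
proof -
  define b where "b n = rGamma (1 + \<mu> - of_int n) * rGamma (1 + \<nu> + of_int n)" for n :: int
  have b_rec: "(\<mu> - of_int n) * b n = (\<nu> + of_int n + 1) * b (n + 1)" for n
  proof -
    have "rGamma (\<mu> - of_int n) = (\<mu> - of_int n) * rGamma (1 + \<mu> - of_int n)"
      using rGamma_plus1[of "\<mu> - of_int n"] by (simp add: algebra_simps)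
    moreover have "rGamma (1 + \<nu> + of_int n) = (\<nu> + of_int n + 1) * rGamma (1 + \<nu> + of_int (n + 1))"
      using rGamma_plus1[of "1 + \<nu> + of_int n"] by (simp add: algebra_simps)
    ultimately show ?thesis by (simp add: b_def)
  qed
  \<comment> \<open>For this \<open>n0\<close> both 1 + \<nu> + n0 and 1 + \<mu> - n0 have positive
    real part, so \<open>b n0\<close> is nonzero. Going up one divides by \<nu> + n + 1, going down
    by \<mu> - (n - 1); their real parts stay positive in the respective direction.\<close>
  define n0 where "n0 = \<lfloor>- Re \<nu>\<rfloor>"
  have n0: "of_int n0 > - Re \<nu> - 1" "of_int n0 \<le> - Re \<nu>" by (simp_all add: n0_def)
  have "b n0 \<noteq> 0"
    using n0 assms by (simp add: b_def rGamma_nonzero_Re)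
  define C where "C = jacobi_coeff \<mu> \<nu> n0 / b n0"
  have "jacobi_coeff \<mu> \<nu> n = C * b n" for n
  proof (cases "n \<ge> n0")
    case True
    then show ?thesis
    proof (induction n rule: int_ge_induct)
      case base
      show ?case using \<open>b n0 \<noteq> 0\<close> by (simp add: C_def)
    next
      case (step n)
      have "Re (\<nu> + of_int n + 1) > 0" using step.hyps n0 by simp
      then have "\<nu> + of_int n + 1 \<noteq> 0" by (metis less_irrefl zero_complex.sel(1))
      moreover have "(\<nu> + of_int n + 1) * jacobi_coeff \<mu> \<nu> (n + 1) = (\<nu> + of_int n + 1) * (C * b (n + 1))"
        using jacobi_coeff_rec[OF assms, of n] b_rec[of n] step.IH by (metis mult.left_commute)
      ultimately show ?case by (metis mult_left_cancel)
    qed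
  next
    case False
    then have "n \<le> n0" by simp
    then show ?thesis
    proof (induction n rule: int_le_induct)
      case base
      show ?case using \<open>b n0 \<noteq> 0\<close> by (simp add: C_def)
    next
      case (step n)
      have "Re (\<mu> - of_int (n - 1)) > 0" using step.hyps n0 assms by simp
      then have "\<mu> - of_int (n - 1) \<noteq> 0" by (metis less_irrefl zero_complex.sel(1))
      moreover have "(\<mu> - of_int (n - 1)) * jacobi_coeff \<mu> \<nu> (n - 1) = (\<mu> - of_int (n - 1)) * (C * b (n - 1))"
        using jacobi_coeff_rec[OF assms, of "n - 1"] b_rec[of "n - 1"] step.IH
        by (metis diff_add_cancel mult.left_commute)
      ultimately show ?case by (metis mult_left_cancel)
    qed
  qed
  then show ?thesis unfolding b_def by (rule that)
qed

section \<open>Fourier coefficients for arbitrary \<open>t\<close>\<close>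

lemma weight_cis:
  assumes "-pi \<le> \<theta>" "\<theta> \<le> pi"
  shows "weight \<mu> \<nu> t (cis \<theta>) * exp (- \<i> * of_int n * of_real \<theta>) =
    circle_kernel (\<mu> + \<nu>) ((\<mu> - \<nu>) / 2 - of_int n) \<theta> * exp (t * cis \<theta>)"
proof -
  have c: "cos (\<theta> / 2) \<ge> 0" using assms by (intro cos_ge_zero) auto
  have "1 + cis \<theta> = of_real (2 * cos (\<theta> / 2)) * cis (\<theta> / 2)"
  proof -
    have "of_real (2 * cos (\<theta> / 2)) = cis (\<theta> / 2) + cis (- (\<theta> / 2))"
      by (simp add: complex_eq_iff)
    then show ?thesis by (simp add: ring_distribs cis_mult)
  qed
  then have norm: "cmod (1 + cis \<theta>) = 2 * cos (\<theta> / 2)"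
    using c by (simp add: norm_mult)
  show ?thesis
  \<comment> \<open>At -pi the principal argument is pi instead of \<theta>, but both sides vanish
    there because 1 + z = 0.\<close>
  proof (cases "\<theta> = - pi")
    case True
    then show ?thesis by (simp add: weight_def circle_kernel_def cis_conv_exp exp_minus)
  next
    case False
    then have "Arg (cis \<theta>) = \<theta>" using assms by (intro Arg_cis) auto
    moreover have "exp (of_real \<theta> * (\<i> * ((\<mu> - \<nu>) / 2 - of_int n))) =
        exp (\<i> * of_real \<theta> * (\<mu> - \<nu>) / 2) * exp (- \<i> * of_int n * of_real \<theta>)"
      unfolding exp_add[symmetric] by (simp add: field_simps)
    ultimately show ?thesis
      unfolding weight_def norm circle_kernel_eq_powr[OF assms] by (simp only: mult_ac)
  qed
qed

text \<open>Multiplication by a power of z stays within the family of kernels, so the terms of the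
  exponential series integrate to shifted Fourier coefficients.\<close>

lemma circle_kernel_add_nat: "circle_kernel s (b + of_nat k) \<theta> = circle_kernel s b \<theta> * cis \<theta> ^ k"
  by (simp add: circle_kernel_def cis_conv_exp algebra_simps flip: exp_add exp_of_nat_mult)

text \<open>An integer shift multiplies the kernel by a unimodular factor, so the bound is uniform
  in \<open>n\<close>. It supplies the absolute summability required by the Cauchy--Binet
  expansion.\<close>

lemma norm_jacobi_coeff_le:
  "norm (jacobi_coeff \<mu> \<nu> n) \<le> (\<integral>\<theta>. norm (circle_kernel (\<mu> + \<nu>) ((\<mu> - \<nu>) / 2) \<theta>) \<partial>lborel) / (2 * pi)"
proof -
  have "norm (circle_kernel (\<mu> + \<nu>) ((\<mu> - \<nu>) / 2 - of_int n) \<theta>) = norm (circle_kernel (\<mu> + \<nu>) ((\<mu> - \<nu>) / 2) \<theta>)" for \<theta>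
    by (simp add: circle_kernel_def algebra_simps)
  then show ?thesis
    using integral_norm_bound[of lborel "circle_kernel (\<mu> + \<nu>) ((\<mu> - \<nu>) / 2 - of_int n)"]
    by (simp add: jacobi_coeff_def norm_divide divide_right_mono)
qed

text \<open>The exponential series is integrated term by term: on the circle |z| = 1, so the norms
  of the terms are those of the series of exp |t| times one integrable function.\<close>

lemma fourier_coeff_weight_sums:
  assumes "Re (\<mu> + \<nu>) > -1"
  shows "(\<lambda>k. t ^ k / fact k * jacobi_coeff \<mu> \<nu> (n - int k)) sums fourier_coeff (weight \<mu> \<nu> t) n"
proof -
  define b where "b = (\<mu> - \<nu>) / 2 - of_int n"
  define f where "f k \<theta> = t ^ k / fact k * circle_kernel (\<mu> + \<nu>) (b + of_nat k) \<theta>" for k \<theta>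
  have int: "integrable lborel (circle_kernel (\<mu> + \<nu>) b)" for b
    by (rule integrable_circle_kernel[OF assms])
  have norm_f: "norm (f k \<theta>) = norm t ^ k / fact k * norm (circle_kernel (\<mu> + \<nu>) b \<theta>)" for k \<theta>
    by (simp add: f_def circle_kernel_add_nat norm_mult norm_divide norm_power)
  have exp_summable: "summable (\<lambda>k. norm t ^ k / fact k)"
    using summable_exp[of "norm t"] by (simp add: field_simps)
  have "(\<lambda>k. \<integral>\<theta>. f k \<theta> \<partial>lborel) sums (\<integral>\<theta>. (\<Sum>k. f k \<theta>) \<partial>lborel)"
  proof (rule sums_integral)
    show "integrable lborel (f k)" for k unfolding f_def using int by simp
    show "AE \<theta> in lborel. summable (\<lambda>k. norm (f k \<theta>))"
      unfolding norm_f using exp_summable by (intro AE_I2 summable_mult2)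
    show "summable (\<lambda>k. \<integral>\<theta>. norm (f k \<theta>) \<partial>lborel)"
      unfolding norm_f integral_mult_right_zero using exp_summable by (intro summable_mult2)
  qed
  also have "(\<lambda>k. \<integral>\<theta>. f k \<theta> \<partial>lborel) = (\<lambda>k. 2 * of_real pi * (t ^ k / fact k * jacobi_coeff \<mu> \<nu> (n - int k)))"
    by (simp add: f_def jacobi_coeff_def b_def algebra_simps)
  also have "(\<lambda>\<theta>. \<Sum>k. f k \<theta>) = (\<lambda>\<theta>. circle_kernel (\<mu> + \<nu>) b \<theta> * exp (t * cis \<theta>))"
  proof
    fix \<theta>
    have "(\<lambda>k. circle_kernel (\<mu> + \<nu>) b \<theta> * ((t * cis \<theta>) ^ k /\<^sub>R fact k)) sums
        (circle_kernel (\<mu> + \<nu>) b \<theta> * exp (t * cis \<theta>))"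
      by (intro sums_mult exp_converges)
    moreover have "circle_kernel (\<mu> + \<nu>) b \<theta> * ((t * cis \<theta>) ^ k /\<^sub>R fact k) = f k \<theta>" for k
      by (simp add: f_def circle_kernel_add_nat power_mult_distrib scaleR_conv_of_real field_simps)
    ultimately show "(\<Sum>k. f k \<theta>) = circle_kernel (\<mu> + \<nu>) b \<theta> * exp (t * cis \<theta>)"
      by (simp add: sums_iff)
  qed
  also have "(\<integral>\<theta>. circle_kernel (\<mu> + \<nu>) b \<theta> * exp (t * cis \<theta>) \<partial>lborel) =
      2 * of_real pi * fourier_coeff (weight \<mu> \<nu> t) n"
  proof -
    have "circle_kernel (\<mu> + \<nu>) b \<theta> * exp (t * cis \<theta>) =
        indicator {-pi..pi} \<theta> *\<^sub>R (weight \<mu> \<nu> t (cis \<theta>) * exp (- \<i> * of_int n * of_real \<theta>))" for \<theta>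
    proof (cases "\<theta> \<in> {-pi..pi}")
      case True
      then show ?thesis using weight_cis[of \<theta> \<mu> \<nu> t n] by (simp add: b_def)
    qed (auto simp: circle_kernel_def)
    then show ?thesis
      by (simp add: fourier_coeff_def set_lebesgue_integral_def)
  qed
  finally show ?thesis
    by (subst (asm) sums_mult_iff) auto
qed

section \<open>The Toeplitz determinants as hypergeometric series\<close>

lemma rGamma_diff_of_nat: "rGamma (z - of_nat j) = (\<Prod>i<j. z - 1 - of_nat i) * rGamma (z :: complex)"
proof (induction j)
  case (Suc j)
  have "rGamma (z - of_nat (Suc j)) = (z - 1 - of_nat j) * rGamma (z - of_nat j)"
    using rGamma_plus1[of "z - 1 - of_nat j"] by (simp add: algebra_simps)
  with Suc show ?case by simp
qed simp

text \<open>In each Leibniz term that does not vanish, the exponents of \<open>t\<close> add up to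
  the sum of the \<open>l i - p i\<close>. The staircase part of \<open>l\<close> cancels the sum of
  the permuted indices, which leaves the size of \<kappa>. What remains is a determinant of falling
  factorials; terms with some \<open>p i > l i\<close> vanish in both determinants.\<close>

lemma det_exp_coeffs:
  fixes t :: complex
  assumes \<kappa>: "\<kappa> \<in> partitions N"
  defines "l \<equiv> shifted_part \<kappa>"
  shows "Determinant.det (Matrix.mat N N (\<lambda>(i, k). if k \<le> l i then t ^ (l i - k) / fact (l i - k) else 0)) =
      t ^ sum_list \<kappa> / (\<Prod>i<N. fact (l i)) * vdm N (\<lambda>i. of_nat (l i))"
proof -
  let ?E = "\<lambda>i k. if k \<le> l i then t ^ (l i - k) / fact (l i - k) else 0"
  let ?ff = "\<lambda>i k. \<Prod>m<k. of_nat (l i) - of_nat m :: complex"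
  have "l i = \<kappa> ! i + (N - Suc i)" for i
    using \<kappa> by (simp add: l_def shifted_part_def partitions_def)
  then have "(\<Sum>i<N. l i) = (\<Sum>i<N. \<kappa> ! i) + (\<Sum>i<N. N - Suc i)"
    by (simp only: sum.distrib)
  then have sum_l: "(\<Sum>i<N. l i) = sum_list \<kappa> + (\<Sum>i<N. i)"
    using \<kappa> sum.nat_diff_reindex[of "\<lambda>i. i" N]
    by (simp add: partitions_def sum_list_sum_nth atLeast0LessThan)
  have ff: "?ff i k = (if k \<le> l i then fact (l i) / fact (l i - k) else 0)" for i k
  proof (cases "k \<le> l i")
    case True
    have "?ff i k = fact k * (of_nat (l i) gchoose k)"
      by (simp add: gbinomial_prod_rev atLeast0LessThan)
    also have "\<dots> = fact (l i) / fact (l i - k)"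
      using True by (simp add: binomial_fact flip: binomial_gbinomial)
    finally show ?thesis using True by simp
  next
    case False
    then show ?thesis by (auto intro!: prod_zero bexI[of _ "l i"])
  qed
  have "(\<Prod>i<N. ?E i (p i)) = t ^ sum_list \<kappa> / (\<Prod>i<N. fact (l i)) * (\<Prod>i<N. ?ff i (p i))"
    if p: "p permutes {0..<N}" for p
  proof (cases "\<forall>i<N. p i \<le> l i")
    case True
    have "(\<Sum>i<N. p i) = (\<Sum>i<N. i)"
      using sum.permute[OF p, of "\<lambda>i. i"] by (simp add: atLeast0LessThan)
    moreover have "(\<Sum>i<N. l i) = (\<Sum>i<N. l i - p i) + (\<Sum>i<N. p i)"
      using True by (simp flip: sum.distrib)
    ultimately have s: "(\<Sum>i<N. l i - p i) = sum_list \<kappa>" using sum_l by simp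
    have "(\<Prod>i<N. ?E i (p i)) = (\<Prod>i<N. t ^ (l i - p i) * (1 / fact (l i)) * ?ff i (p i))"
      using True by (intro prod.cong) (auto simp: ff)
    also have "\<dots> = t ^ sum_list \<kappa> * (\<Prod>i<N. 1 / fact (l i)) * (\<Prod>i<N. ?ff i (p i))"
      by (simp only: prod.distrib power_sum[symmetric] s)
    finally show ?thesis by (simp add: prod_dividef)
  next
    case False
    then obtain i where i: "i < N" "\<not> p i \<le> l i" by auto
    have "(\<Prod>i<N. ?E i (p i)) = 0" "(\<Prod>i<N. ?ff i (p i)) = 0"
      by (rule prod_zero; use i in \<open>auto simp: ff intro!: bexI[of _ i]\<close>)+
    then show ?thesis by (simp only: mult_zero_right)
  qed
  then have "Determinant.det (Matrix.mat N N (\<lambda>(i, k). ?E i k)) =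
      t ^ sum_list \<kappa> / (\<Prod>i<N. fact (l i)) * Determinant.det (Matrix.mat N N (\<lambda>(i, k). ?ff i k))"
    unfolding det_mat_rows by (simp add: sum_distrib_left mult_ac)
  also have "Determinant.det (Matrix.mat N N (\<lambda>(i, k). ?ff i k)) = vdm N (\<lambda>i. of_nat (l i))"
    using det_falling[of N "\<lambda>i. of_nat (l i) :: complex"] by (subst det_mat_transpose[symmetric])
  finally show ?thesis .
qed

lemma vdm_translate: "vdm N (\<lambda>i. x i + c) = vdm N x"
  by (simp add: vdm_def)

text \<open>Up to column factors the entries are polynomials of degree less than \<open>N\<close> in \<open>l k + s\<close> that do not
  depend on the shift \<open>s\<close>, so the determinant is a Vandermonde determinant times a factor independent of \<open>s\<close>.\<close>

lemma det_rGamma: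
  fixes \<mu> \<nu> :: complex
  obtains D where
    "\<And>s l. Determinant.det (Matrix.mat N N (\<lambda>(j, k).
         rGamma (1 + (\<mu> + s) + of_nat (l k) - of_nat j) * rGamma (1 + (\<nu> - s) + of_nat j - of_nat (l k)))) =
       (\<Prod>k<N. rGamma (1 + (\<mu> + s) + of_nat (l k)) * rGamma (of_nat N + (\<nu> - s) - of_nat (l k))) *
       D * vdm N (\<lambda>k. of_nat (l k :: nat))"
proof -
  \<comment> \<open>The two products arise from lowering the arguments of the column factors, by
    \<open>j\<close> in the first Gamma and by \<open>N - 1 - j\<close> in the second. The shift
    \<open>s\<close> then moves into the evaluation point, where translation invariance of
    \<open>vdm\<close> removes it.\<close>
  define P where "P j = (\<Prod>i<j. [:\<mu> - of_nat i, 1:]) * (\<Prod>i<N - 1 - j. [:\<nu> + of_nat N - 1 - of_nat i, -1:])" for j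
  have deg: "degree (P j) < N" if "j < N" for j
  proof -
    have "degree (P j) \<le> (\<Sum>i<j. 1) + (\<Sum>i<N - 1 - j. 1)"
      unfolding P_def
      by (intro order.trans[OF degree_mult_le] add_mono order.trans[OF degree_prod_sum_le] sum_mono) auto
    then show ?thesis using that by simp
  qed
  define D where "D = Determinant.det (Matrix.mat N N (\<lambda>(j, k). coeff (P j) k))"
  show ?thesis
  proof (rule that[of D])
    fix s and l :: "nat \<Rightarrow> nat"
    have "rGamma (1 + (\<mu> + s) + of_nat (l k) - of_nat j) * rGamma (1 + (\<nu> - s) + of_nat j - of_nat (l k)) =
        (rGamma (1 + (\<mu> + s) + of_nat (l k)) * rGamma (of_nat N + (\<nu> - s) - of_nat (l k))) *
        poly (P j) (of_nat (l k) + s)" if "j < N" for j k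
    proof -
      have "1 + (\<nu> - s) + of_nat j - of_nat (l k) = (of_nat N + (\<nu> - s) - of_nat (l k)) - of_nat (N - 1 - j)"
        using that by (simp add: of_nat_diff)
      then have "rGamma (1 + (\<nu> - s) + of_nat j - of_nat (l k)) =
          (\<Prod>i<N - 1 - j. of_nat N + (\<nu> - s) - of_nat (l k) - 1 - of_nat i) * rGamma (of_nat N + (\<nu> - s) - of_nat (l k))"
        by (simp only: rGamma_diff_of_nat)
      then show ?thesis
        unfolding rGamma_diff_of_nat P_def poly_mult poly_prod by (simp add: algebra_simps)
    qed
    then have "Determinant.det (Matrix.mat N N (\<lambda>(j, k).
         rGamma (1 + (\<mu> + s) + of_nat (l k) - of_nat j) * rGamma (1 + (\<nu> - s) + of_nat j - of_nat (l k)))) =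
       Determinant.det (Matrix.mat N N (\<lambda>(j, k).
        (rGamma (1 + (\<mu> + s) + of_nat (l k)) * rGamma (of_nat N + (\<nu> - s) - of_nat (l k))) *
        poly (P j) (of_nat (l k) + s)))"
      by (intro arg_cong[where f = Determinant.det] eq_matI) simp_all
    also have "\<dots> = (\<Prod>k<N. rGamma (1 + (\<mu> + s) + of_nat (l k)) * rGamma (of_nat N + (\<nu> - s) - of_nat (l k))) *
        Determinant.det (Matrix.mat N N (\<lambda>(j, k). poly (P j) (of_nat (l k) + s)))"
      by (rule det_mat_scale_cols)
    also have "Determinant.det (Matrix.mat N N (\<lambda>(j, k). poly (P j) (of_nat (l k) + s))) =
        D * vdm N (\<lambda>k. of_nat (l k))"
      unfolding D_def using det_mat_poly[where n = N and p = P and x = "\<lambda>k. of_nat (l k) + s"] deg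
      by (simp add: det_vandermonde vdm_translate)
    finally show "Determinant.det (Matrix.mat N N (\<lambda>(j, k).
         rGamma (1 + (\<mu> + s) + of_nat (l k) - of_nat j) * rGamma (1 + (\<nu> - s) + of_nat j - of_nat (l k)))) =
       (\<Prod>k<N. rGamma (1 + (\<mu> + s) + of_nat (l k)) * rGamma (of_nat N + (\<nu> - s) - of_nat (l k))) *
       D * vdm N (\<lambda>k. of_nat (l k))"
      by (simp add: mult.assoc)
  qed
qed

text \<open>The product of column factors of the left-hand minor at the empty partition, where the
  shifted parts are \<open>N - 1 - k\<close>.\<close>

definition rGamma_prod :: "nat \<Rightarrow> complex \<Rightarrow> complex \<Rightarrow> complex" where
  "rGamma_prod N \<mu> \<nu> = (\<Prod>k<N. rGamma (of_nat N + \<mu> - of_nat k) * rGamma (\<nu> + 1 + of_nat k))"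

text \<open>Every factor changes by one step of the functional equation. This is the origin of the
  Pochhammer quotients in front of the series; the product form also covers vanishing Pochhammer
  symbols.\<close>

lemma rGamma_prod_shift:
  "rGamma_prod N (\<mu> + 1) (\<nu> - 1) * pochhammer (\<mu> + 1) N = pochhammer \<nu> N * rGamma_prod N \<mu> \<nu>"
proof -
  have "pochhammer (\<mu> + 1) N = (\<Prod>k<N. \<mu> + 1 + of_nat (N - Suc k))"
    using prod.nat_diff_reindex[of "\<lambda>i. \<mu> + 1 + of_nat i" N]
    by (simp add: pochhammer_prod atLeast0LessThan)
  also have "\<dots> = (\<Prod>k<N. of_nat N + \<mu> - of_nat k)"
    by (intro prod.cong) (auto simp: of_nat_diff)
  finally have p: "pochhammer (\<mu> + 1) N = (\<Prod>k<N. of_nat N + \<mu> - of_nat k)" .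
  have "rGamma (of_nat N + (\<mu> + 1) - of_nat k) * rGamma (\<nu> - 1 + 1 + of_nat k) * (of_nat N + \<mu> - of_nat k) =
      (\<nu> + of_nat k) * (rGamma (of_nat N + \<mu> - of_nat k) * rGamma (\<nu> + 1 + of_nat k))" for k
  proof -
    have "rGamma (of_nat N + \<mu> - of_nat k) = (of_nat N + \<mu> - of_nat k) * rGamma (of_nat N + (\<mu> + 1) - of_nat k)"
      using rGamma_plus1[of "of_nat N + \<mu> - of_nat k"] by (simp add: algebra_simps)
    moreover have "rGamma (\<nu> - 1 + 1 + of_nat k) = (\<nu> + of_nat k) * rGamma (\<nu> + 1 + of_nat k)"
      using rGamma_plus1[of "\<nu> + of_nat k"] by (simp add: algebra_simps)
    ultimately show ?thesis by simp
  qed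
  then show ?thesis
    unfolding rGamma_prod_def p pochhammer_prod[of \<nu>] by (simp add: atLeast0LessThan flip: prod.distrib)
qed

text \<open>Row by row, relative to the empty partition, the first argument rises by
  \<open>\<kappa> ! k\<close>, which divides by a Pochhammer symbol. The second falls by the same
  amount, which multiplies by a falling product; negating each of its factors turns \<open>t\<close>
  into \<open>- t\<close>. The lowest base point in the denominators is \<mu> + 1, hence the
  hypothesis.\<close>

lemma rGamma_pochhammer_prod:
  assumes \<kappa>: "\<kappa> \<in> partitions N" and \<mu>: "\<mu> + 1 \<notin> \<int>\<^sub>\<le>\<^sub>0"
  shows "(\<Prod>k<N. rGamma (1 + \<mu> + of_nat (shifted_part \<kappa> k)) * rGamma (of_nat N + \<nu> - of_nat (shifted_part \<kappa> k))) *
      t ^ sum_list \<kappa> =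
    rGamma_prod N \<mu> \<nu> * (gen_pochhammer (- \<nu>) \<kappa> / gen_pochhammer (of_nat N + \<mu>) \<kappa>) * (- t) ^ sum_list \<kappa>"
proof -
  have len: "length \<kappa> = N" using \<kappa> by (simp add: partitions_def)
  have "rGamma (1 + \<mu> + of_nat (shifted_part \<kappa> k)) * rGamma (of_nat N + \<nu> - of_nat (shifted_part \<kappa> k)) * t ^ (\<kappa> ! k) =
      (rGamma (of_nat N + \<mu> - of_nat k) * rGamma (\<nu> + 1 + of_nat k)) *
      (pochhammer (- \<nu> - of_nat k) (\<kappa> ! k) / pochhammer (of_nat N + \<mu> - of_nat k) (\<kappa> ! k)) * (- t) ^ (\<kappa> ! k)"
    if k: "k < N" for k
  proof -
    have l: "of_nat (shifted_part \<kappa> k) = (of_nat (\<kappa> ! k) + of_nat N - 1 - of_nat k :: complex)"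
      using k len by (simp add: shifted_part_def of_nat_diff)
    have "pochhammer (of_nat N + \<mu> - of_nat k) (\<kappa> ! k) \<noteq> 0"
    proof
      assume "pochhammer (of_nat N + \<mu> - of_nat k) (\<kappa> ! k) = 0"
      then obtain m where "of_nat N + \<mu> - of_nat k = - of_nat m" by (auto simp: pochhammer_eq_0_iff)
      then have "\<mu> + 1 = - of_nat (m + (N - 1 - k))"
        using k by (simp add: of_nat_diff algebra_simps)
      then have "\<mu> + 1 \<in> \<int>\<^sub>\<le>\<^sub>0" by (simp only: minus_of_nat_in_nonpos_Ints)
      then show False using \<mu> by simp
    qed
    moreover have "rGamma (of_nat N + \<mu> - of_nat k) =
        pochhammer (of_nat N + \<mu> - of_nat k) (\<kappa> ! k) * rGamma (1 + \<mu> + of_nat (shifted_part \<kappa> k))"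
      using pochhammer_rGamma[of "of_nat N + \<mu> - of_nat k" "\<kappa> ! k"] by (simp add: l algebra_simps)
    moreover have "rGamma (of_nat N + \<nu> - of_nat (shifted_part \<kappa> k)) * t ^ (\<kappa> ! k) =
        rGamma (\<nu> + 1 + of_nat k) * pochhammer (- \<nu> - of_nat k) (\<kappa> ! k) * (- t) ^ (\<kappa> ! k)"
    proof -
      have "of_nat N + \<nu> - of_nat (shifted_part \<kappa> k) = \<nu> + 1 + of_nat k - of_nat (\<kappa> ! k)"
        by (simp add: l)
      then have "rGamma (of_nat N + \<nu> - of_nat (shifted_part \<kappa> k)) * t ^ (\<kappa> ! k) =
          (\<Prod>i<\<kappa> ! k. \<nu> + 1 + of_nat k - 1 - of_nat i) * rGamma (\<nu> + 1 + of_nat k) * (\<Prod>i<\<kappa> ! k. t)"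
        by (simp only: rGamma_diff_of_nat prod_constant card_lessThan)
      also have "\<dots> = rGamma (\<nu> + 1 + of_nat k) * (\<Prod>i<\<kappa> ! k. (\<nu> + 1 + of_nat k - 1 - of_nat i) * t)"
        by (simp add: prod.distrib)
      also have "\<dots> = rGamma (\<nu> + 1 + of_nat k) * (\<Prod>i<\<kappa> ! k. (- \<nu> - of_nat k + of_nat i) * (- t))"
      proof -
        have "(\<nu> + 1 + of_nat k - 1 - of_nat i) * t = (- \<nu> - of_nat k + of_nat i) * (- t)" for i
          by (simp add: algebra_simps)
        then show ?thesis by (simp only:)
      qed
      also have "\<dots> = rGamma (\<nu> + 1 + of_nat k) * (pochhammer (- \<nu> - of_nat k) (\<kappa> ! k) * (- t) ^ (\<kappa> ! k))"
        by (simp only: prod.distrib pochhammer_prod prod_constant card_lessThan atLeast0LessThan)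
      finally show ?thesis by (simp only: mult.assoc)
    qed
    ultimately show ?thesis by (simp add: field_simps)
  qed
  then have "(\<Prod>k<N. rGamma (1 + \<mu> + of_nat (shifted_part \<kappa> k)) * rGamma (of_nat N + \<nu> - of_nat (shifted_part \<kappa> k)) * t ^ (\<kappa> ! k)) =
    (\<Prod>k<N. (rGamma (of_nat N + \<mu> - of_nat k) * rGamma (\<nu> + 1 + of_nat k)) *
      (pochhammer (- \<nu> - of_nat k) (\<kappa> ! k) / pochhammer (of_nat N + \<mu> - of_nat k) (\<kappa> ! k)) * (- t) ^ (\<kappa> ! k))"
    by (intro prod.cong) auto
  moreover have "sum_list \<kappa> = (\<Sum>k<N. \<kappa> ! k)"
    by (simp add: sum_list_sum_nth len atLeast0LessThan)
  ultimately show ?thesis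
    by (simp only: prod.distrib prod_dividef power_sum rGamma_prod_def gen_pochhammer_def len)
qed

text \<open>One Vandermonde factor comes from the tableau count, the other from the reciprocal hook
  product. The constant is the same for all \<kappa>.\<close>

lemma schur_over_hook:
  obtains c :: complex where "c \<noteq> 0"
    "\<And>\<kappa>. \<kappa> \<in> partitions N \<Longrightarrow> schur \<kappa> (replicate N x) / of_nat (hook_prod \<kappa>) =
      c * x ^ sum_list \<kappa> * (vdm N (\<lambda>i. of_nat (shifted_part \<kappa> i)))\<^sup>2 / (\<Prod>i<N. fact (shifted_part \<kappa> i))"
proof -
  obtain c :: complex where c: "c \<noteq> 0"
    "\<And>\<kappa>. \<kappa> \<in> partitions N \<Longrightarrow> of_nat (card (ssyt \<kappa> N)) = c * vdm N (\<lambda>i. of_nat (shifted_part \<kappa> i))"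
    by (rule card_ssyt_vdm[of N]) blast
  define s :: complex where "s = (\<Prod>j<N. \<Prod>i<j. -1)"
  have s: "s \<noteq> 0" by (simp add: s_def)
  show ?thesis
  proof (rule that[of "c / s"])
    fix \<kappa> assume \<kappa>: "\<kappa> \<in> partitions N"
    let ?v = "vdm N (\<lambda>i. of_nat (shifted_part \<kappa> i)) :: complex"
    let ?F = "\<Prod>i<N. fact (shifted_part \<kappa> i) :: complex"
    define V where "V = (\<Prod>i<N. \<Prod>i'\<in>{i<..<N}. shifted_part \<kappa> i - shifted_part \<kappa> i')"
    have "of_nat (hook_prod \<kappa> * V) = ?F"
      unfolding V_def hook_prod_formula[OF \<kappa>] by simp
    moreover have "?v = s * of_nat V"
      unfolding V_def s_def by (rule vdm_shifted_part[OF \<kappa>])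
    moreover have "?F \<noteq> 0" by simp
    moreover have "of_nat (hook_prod \<kappa>) \<noteq> (0 :: complex)" using hook_prod_pos[of \<kappa>] by simp
    ultimately have "1 / of_nat (hook_prod \<kappa>) = ?v / s / ?F" using s by (auto simp: field_simps)
    then show "schur \<kappa> (replicate N x) / of_nat (hook_prod \<kappa>) = c / s * x ^ sum_list \<kappa> * ?v\<^sup>2 / ?F"
      unfolding schur_replicate c(2)[OF \<kappa>] divide_inverse[of _ "of_nat (hook_prod \<kappa>)"]
      by (simp add: inverse_eq_divide power2_eq_square)
  qed (use c s in simp)
qed

text \<open>The factor \<open>K\<close> is fixed before \<epsilon>, so that it drops out of
  quotients of determinants with different shifts.\<close>

theorem toeplitz_det_hypergeom:
  assumes "Re (\<mu> + \<nu>) > -1"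
  obtains K where
    "\<And>\<epsilon>. \<mu> + of_int \<epsilon> + 1 \<notin> \<int>\<^sub>\<le>\<^sub>0 \<Longrightarrow> toeplitz_det (weight \<mu> \<nu> t) \<epsilon> N =
      K * rGamma_prod N (\<mu> + of_int \<epsilon>) (\<nu> - of_int \<epsilon>) *
      hypergeom [- (\<nu> - of_int \<epsilon>)] [of_nat N + (\<mu> + of_int \<epsilon>)] (replicate N (- t))"
proof -
  let ?a = "jacobi_coeff \<mu> \<nu>"
  let ?E = "\<lambda>l k. if k \<le> l then t ^ (l - k) / fact (l - k) else 0"
  obtain C where C: "\<And>n. ?a n = C * (rGamma (1 + \<mu> - of_int n) * rGamma (1 + \<nu> + of_int n))"
    by (rule jacobi_coeff_rGamma[OF assms]) blast
  obtain D where D: "\<And>s l. Determinant.det (Matrix.mat N N (\<lambda>(j, k).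
         rGamma (1 + (\<mu> + s) + of_nat (l k) - of_nat j) * rGamma (1 + (\<nu> - s) + of_nat j - of_nat (l k)))) =
       (\<Prod>k<N. rGamma (1 + (\<mu> + s) + of_nat (l k)) * rGamma (of_nat N + (\<nu> - s) - of_nat (l k))) *
       D * vdm N (\<lambda>k. of_nat (l k :: nat))"
    by (rule det_rGamma[of N \<mu> \<nu>]) blast
  obtain c where c: "c \<noteq> 0" "\<And>\<kappa>. \<kappa> \<in> partitions N \<Longrightarrow> schur \<kappa> (replicate N (- t)) / of_nat (hook_prod \<kappa>) =
      c * (- t) ^ sum_list \<kappa> * (vdm N (\<lambda>i. of_nat (shifted_part \<kappa> i)))\<^sup>2 / (\<Prod>i<N. fact (shifted_part \<kappa> i))"
    by (rule schur_over_hook[of N "- t"]) blast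
  define A where "A = (\<integral>\<theta>. norm (circle_kernel (\<mu> + \<nu>) ((\<mu> - \<nu>) / 2) \<theta>) \<partial>lborel) / (2 * pi)"
  have entry: "Infinite_Sum.abs_summable_on (\<lambda>l. ?a (- \<epsilon> + int j - int l) * ?E l k) UNIV"
      "(\<Sum>\<^sub>\<infinity>l. ?a (- \<epsilon> + int j - int l) * ?E l k) = fourier_coeff (weight \<mu> \<nu> t) (- \<epsilon> + int j - int k)"
    for \<epsilon> j k
  proof -
    define f where "f l = ?a (- \<epsilon> + int j - int l) * ?E l k" for l
    have f: "f (m + k) = t ^ m / fact m * ?a (- \<epsilon> + int j - int k - int m)" for m
      by (simp add: f_def algebra_simps)
    have f0: "f l = 0" if "l < k" for l using that by (simp add: f_def)
    have "summable (\<lambda>m. norm (f (m + k)))"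
    proof (rule summable_comparison_test'[of "\<lambda>m. norm t ^ m / fact m * A" 0])
      show "summable (\<lambda>m. norm t ^ m / fact m * A)"
        using summable_exp[of "norm t"] by (intro summable_mult2) (simp add: field_simps)
      fix m
      have "norm (norm (f (m + k))) = norm t ^ m / fact m * norm (?a (- \<epsilon> + int j - int k - int m))"
        unfolding f by (simp add: norm_mult norm_divide norm_power)
      also have "\<dots> \<le> norm t ^ m / fact m * A"
        unfolding A_def by (intro mult_left_mono norm_jacobi_coeff_le) simp
      finally show "norm (norm (f (m + k))) \<le> norm t ^ m / fact m * A" .
    qed
    then have n: "summable (\<lambda>l. norm (f l))"
      by (simp only: summable_iff_shift[of "\<lambda>l. norm (f l)" k])
    then have "Infinite_Sum.abs_summable_on f UNIV"
      by (intro norm_summable_imp_summable_on) simp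
    then show "Infinite_Sum.abs_summable_on (\<lambda>l. ?a (- \<epsilon> + int j - int l) * ?E l k) UNIV"
      by (simp add: f_def[abs_def])
    have "(\<lambda>m. f (m + k)) sums fourier_coeff (weight \<mu> \<nu> t) (- \<epsilon> + int j - int k)"
      unfolding f by (rule fourier_coeff_weight_sums[OF assms])
    then have "f sums fourier_coeff (weight \<mu> \<nu> t) (- \<epsilon> + int j - int k)"
      using f0 by (simp add: sums_zero_iff_shift)
    then have "(f has_sum fourier_coeff (weight \<mu> \<nu> t) (- \<epsilon> + int j - int k)) UNIV"
      by (rule norm_summable_imp_has_sum[OF n])
    then show "(\<Sum>\<^sub>\<infinity>l. ?a (- \<epsilon> + int j - int l) * ?E l k) = fourier_coeff (weight \<mu> \<nu> t) (- \<epsilon> + int j - int k)"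
      by (intro infsumI) (simp add: f_def[abs_def])
  qed
  define K where "K = C ^ N * D / c"
  show ?thesis
  proof (rule that[of K])
    fix \<epsilon> :: int assume \<epsilon>: "\<mu> + of_int \<epsilon> + 1 \<notin> \<int>\<^sub>\<le>\<^sub>0"
    let ?\<mu> = "\<mu> + of_int \<epsilon>" and ?\<nu> = "\<nu> - of_int \<epsilon>"
    let ?h = "\<lambda>\<kappa>. gen_pochhammer (- ?\<nu>) \<kappa> / gen_pochhammer (of_nat N + ?\<mu>) \<kappa> *
      (schur \<kappa> (replicate N (- t)) / of_nat (hook_prod \<kappa>))"
    have "((\<lambda>\<kappa>. Determinant.det (Matrix.mat N N (\<lambda>(j, k). ?a (- \<epsilon> + int j - int (shifted_part \<kappa> k)))) *
              Determinant.det (Matrix.mat N N (\<lambda>(i, k). ?E (shifted_part \<kappa> i) k)))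
          has_sum toeplitz_det (weight \<mu> \<nu> t) \<epsilon> N) (partitions N)"
      using cauchy_binet_has_sum[of N "\<lambda>j l. ?a (- \<epsilon> + int j - int l)" ?E, OF entry(1)]
      unfolding entry(2) toeplitz_det_def .
    moreover have "Determinant.det (Matrix.mat N N (\<lambda>(j, k). ?a (- \<epsilon> + int j - int (shifted_part \<kappa> k)))) *
        Determinant.det (Matrix.mat N N (\<lambda>(i, k). ?E (shifted_part \<kappa> i) k)) =
        K * rGamma_prod N ?\<mu> ?\<nu> * ?h \<kappa>" if \<kappa>: "\<kappa> \<in> partitions N" for \<kappa>
    proof -
      let ?l = "shifted_part \<kappa>"
      let ?R = "\<Prod>k<N. rGamma (1 + ?\<mu> + of_nat (?l k)) * rGamma (of_nat N + ?\<nu> - of_nat (?l k))"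
      let ?v = "vdm N (\<lambda>k. of_nat (?l k)) :: complex"
      let ?F = "\<Prod>i<N. fact (?l i) :: complex"
      \<comment> \<open>Substituting the index into the closed form shows that \<epsilon> acts as
        the shift \<open>s = \<epsilon>\<close>: it is added to \<mu> and subtracted from
        \<nu>.\<close>
      have "Determinant.det (Matrix.mat N N (\<lambda>(j, k). ?a (- \<epsilon> + int j - int (?l k)))) =
          Determinant.det (Matrix.mat N N (\<lambda>(j, k).
            C * (rGamma (1 + ?\<mu> + of_nat (?l k) - of_nat j) * rGamma (1 + ?\<nu> + of_nat j - of_nat (?l k)))))"
        unfolding C by (intro arg_cong[where f = Determinant.det] eq_matI) (simp_all add: algebra_simps)
      also have "\<dots> = C ^ N * (?R * D * ?v)"
        unfolding det_mat_scale_cols D by simp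
      finally have B: "Determinant.det (Matrix.mat N N (\<lambda>(j, k). ?a (- \<epsilon> + int j - int (?l k)))) =
          C ^ N * (?R * D * ?v)" .
      have "C ^ N * (?R * D * ?v) * (t ^ sum_list \<kappa> / ?F * ?v) = C ^ N * D * (?R * t ^ sum_list \<kappa>) * ?v\<^sup>2 / ?F"
        by (simp add: power2_eq_square)
      also have "\<dots> = K * rGamma_prod N ?\<mu> ?\<nu> * ?h \<kappa>"
        unfolding rGamma_pochhammer_prod[OF \<kappa> \<epsilon>] c(2)[OF \<kappa>] K_def using c(1) by simp
      finally show ?thesis
        unfolding B det_exp_coeffs[OF \<kappa>] .
    qed
    ultimately have "((\<lambda>\<kappa>. K * rGamma_prod N ?\<mu> ?\<nu> * ?h \<kappa>) has_sum toeplitz_det (weight \<mu> \<nu> t) \<epsilon> N) (partitions N)"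
      by (simp cong: has_sum_cong)
    then have "toeplitz_det (weight \<mu> \<nu> t) \<epsilon> N = (\<Sum>\<^sub>\<infinity>\<kappa>\<in>partitions N. K * rGamma_prod N ?\<mu> ?\<nu> * ?h \<kappa>)"
      by (rule infsumI[symmetric])
    also have "\<dots> = K * rGamma_prod N ?\<mu> ?\<nu> * (\<Sum>\<^sub>\<infinity>\<kappa>\<in>partitions N. ?h \<kappa>)"
      by (rule infsum_cmult_right')
    finally show "toeplitz_det (weight \<mu> \<nu> t) \<epsilon> N =
        K * rGamma_prod N ?\<mu> ?\<nu> * hypergeom [- ?\<nu>] [of_nat N + ?\<mu>] (replicate N (- t))"
      by (simp add: hypergeom_def)
  qed
qed

section \<open>Quotients of the Toeplitz determinants\<close>

lemma not_nonpos_Int_add_1: "(z :: complex) \<notin> \<int>\<^sub>\<le>\<^sub>0 \<Longrightarrow> z + 1 \<notin> \<int>\<^sub>\<le>\<^sub>0"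
  using plus_one_in_nonpos_Ints_imp by blast

text \<open>The base points in the denominators of the series run down to \<mu> + 1 for the lower
  parameter N + \<mu>, and down to \<mu> for N - 1 + \<mu>. The premises of the two implications
  keep them off the nonpositive integers, so no summand contains a division by zero.\<close>

theorem mainTheorem9:
  fixes \<mu> \<nu> t :: complex and N :: nat
  assumes "Re (\<mu> + \<nu>) > -1"
    and "\<And>n. n \<ge> 1 \<Longrightarrow> toeplitz_det (weight \<mu> \<nu> t) 0 n \<noteq> 0"
    and "N \<ge> 1"
  shows "(\<mu> + 1 \<notin> \<int>\<^sub>\<le>\<^sub>0 \<longrightarrow>
            refl_coeff (weight \<mu> \<nu> t) N =
              (-1) ^ N * (pochhammer \<nu> N / pochhammer (\<mu> + 1) N)
              * (hypergeom [- \<nu> + 1] [of_nat N + 1 + \<mu>] (replicate N (- t))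
                 / hypergeom [- \<nu>] [of_nat N + \<mu>] (replicate N (- t))))
       \<and> (\<mu> \<notin> \<int>\<^sub>\<le>\<^sub>0 \<longrightarrow>
            refl_coeff_bar (weight \<mu> \<nu> t) N =
              (-1) ^ N * (pochhammer \<mu> N / pochhammer (\<nu> + 1) N)
              * (hypergeom [- \<nu> - 1] [of_nat N - 1 + \<mu>] (replicate N (- t))
                 / hypergeom [- \<nu>] [of_nat N + \<mu>] (replicate N (- t))))"
proof -
  let ?I = "\<lambda>\<epsilon>. toeplitz_det (weight \<mu> \<nu> t) \<epsilon> N"
  let ?H = "\<lambda>\<epsilon>. hypergeom [- (\<nu> - of_int \<epsilon>)] [of_nat N + (\<mu> + of_int \<epsilon>)] (replicate N (- t))"
  let ?G = "\<lambda>\<epsilon>. rGamma_prod N (\<mu> + of_int \<epsilon>) (\<nu> - of_int \<epsilon>)"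
  obtain K where K: "\<And>\<epsilon>. \<mu> + of_int \<epsilon> + 1 \<notin> \<int>\<^sub>\<le>\<^sub>0 \<Longrightarrow> ?I \<epsilon> = K * ?G \<epsilon> * ?H \<epsilon>"
    by (rule toeplitz_det_hypergeom[OF assms(1), of t N]) blast
  have I0: "?I 0 \<noteq> 0" using assms(2)[OF assms(3)] .
  show ?thesis
  proof (intro conjI impI)
    assume \<mu>: "\<mu> + 1 \<notin> \<int>\<^sub>\<le>\<^sub>0"
    have nz: "K * ?G 0 * ?H 0 \<noteq> 0" using K[of 0] \<mu> I0 by simp
    have "pochhammer (\<mu> + 1) N \<noteq> 0"
      using \<mu> by (auto simp: pochhammer_eq_0_iff)
    then have "?G 1 = pochhammer \<nu> N / pochhammer (\<mu> + 1) N * ?G 0"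
      using rGamma_prod_shift[of N \<mu> \<nu>] by (simp add: field_simps)
    moreover have "?I 1 = K * ?G 1 * ?H 1"
      using not_nonpos_Int_add_1[OF \<mu>] by (intro K) simp
    ultimately have "?I 1 / ?I 0 = pochhammer \<nu> N / pochhammer (\<mu> + 1) N * (?H 1 / ?H 0)"
      using nz K[of 0] \<mu> by (simp add: field_simps)
    then show "refl_coeff (weight \<mu> \<nu> t) N = (-1) ^ N * (pochhammer \<nu> N / pochhammer (\<mu> + 1) N)
        * (hypergeom [- \<nu> + 1] [of_nat N + 1 + \<mu>] (replicate N (- t))
           / hypergeom [- \<nu>] [of_nat N + \<mu>] (replicate N (- t)))"
      by (simp add: refl_coeff_def add_ac mult.assoc flip: times_divide_eq_right)
  next
    assume \<mu>: "\<mu> \<notin> \<int>\<^sub>\<le>\<^sub>0"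
    have nz: "K * ?G 0 * ?H 0 \<noteq> 0" using K[of 0] not_nonpos_Int_add_1[OF \<mu>] I0 by simp
    have G: "?G 0 * pochhammer \<mu> N = pochhammer (\<nu> + 1) N * ?G (-1)"
      using rGamma_prod_shift[of N "\<mu> - 1" "\<nu> + 1"] by simp
    have "pochhammer \<mu> N \<noteq> 0"
      using \<mu> by (auto simp: pochhammer_eq_0_iff)
    \<comment> \<open>The nonvanishing determinant forces \<open>?G 0\<close> to be nonzero, so the
      left side of \<open>G\<close> is nonzero and hence each factor on the right.\<close>
    with G nz have "pochhammer (\<nu> + 1) N \<noteq> 0" by auto
    with G have "?G (-1) = pochhammer \<mu> N / pochhammer (\<nu> + 1) N * ?G 0"
      by (simp add: field_simps)
    moreover have "?I (-1) = K * ?G (-1) * ?H (-1)"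
      using \<mu> by (intro K) simp
    ultimately have "?I (-1) / ?I 0 = pochhammer \<mu> N / pochhammer (\<nu> + 1) N * (?H (-1) / ?H 0)"
      using nz K[of 0] not_nonpos_Int_add_1[OF \<mu>] by (simp add: field_simps)
    moreover have "?H (-1) = hypergeom [- \<nu> - 1] [of_nat N - 1 + \<mu>] (replicate N (- t))"
    proof -
      have "- (\<nu> - of_int (-1)) = - \<nu> - 1" "of_nat N + (\<mu> + of_int (-1)) = of_nat N - 1 + \<mu>" by simp_all
      then show ?thesis by (simp only:)
    qed
    ultimately show "refl_coeff_bar (weight \<mu> \<nu> t) N = (-1) ^ N * (pochhammer \<mu> N / pochhammer (\<nu> + 1) N)
        * (hypergeom [- \<nu> - 1] [of_nat N - 1 + \<mu>] (replicate N (- t))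
           / hypergeom [- \<nu>] [of_nat N + \<mu>] (replicate N (- t)))"
      by (simp add: refl_coeff_bar_def mult.assoc flip: times_divide_eq_right del: of_int_minus)
  qed
qed

end
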